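(* Let $(H,\Delta,S,\varepsilon)$ be a Hopf algebra over a field $k$ with bijective antipode, and let $\eta$ be a normal right $2$-cocycle, i.e. a bilinear map $\eta:H\otimes H\to k$ such that $$\eta(f'g',h)\,\eta(f'',g'')=\eta(f,g'h')\,\eta(g'',h''),\qquad \eta(1,h)=\eta(h,1)=\varepsilon(h)$$ for all $f,g,h\in H$. Let $H_\star=(H,\star)$ denote the associative algebra with the product $g\star h=g'h'\,\eta(g'',h'')$, and let $\mathsf s:H\to H$ be given by $\mathsf s(h)=\eta(h',h'')S(h''')$. If the conditions $$\eta(\mathsf s(h'),h'')=\varepsilon(h),\qquad \eta(h',\mathsf s(h''))=\varepsilon(h),\qquad \eta(g',h')\,\eta(\mathsf s(h''),\mathsf s(g''))=\eta(g'h',g''h'')$$ hold for all $g,h\in H$, then $H_\star$ is a left--left Yetter--Drinfeld $H$-module algebra under the left $H$-action $$g\triangleright h=g'\star h\star\mathsf s(g'')$$ and the left coaction $\delta=\Delta$, viewed as a map $H_\star\to H\otimes H_\star$. Moreover, $H_\star$ is braided commutative.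
   Context: Primes denote Sweedler components of the coproduct: $\Delta(h)=h'\otimes h''$, iterated $h'\otimes h''\otimes h'''$. A left--left Yetter--Drinfeld $H$-module algebra is an algebra $X$ that is a left $H$-module algebra (action $\triangleright$) and a left $H$-comodule algebra (coaction $\delta:X\to H\otimes X$, $\delta(x)=x_{(-1)}\otimes x_{(0)}$, an algebra homomorphism) such that $(h'\triangleright x)_{(-1)}h''\otimes(h'\triangleright x)_{(0)}=h'x_{(-1)}\otimes(h''\triangleright x_{(0)})$ for all $h\in H$, $x\in X$. It is braided commutative if $yx=(y_{(-1)}\triangleright x)\,y_{(0)}$ for all $x,y\in X$. *)

theory Defs
  imports Complex_Main "HOL-Library.Function_Algebras"
begin

section \<open>Tensor products over a field\<close>

definition bilinear_map ::
    "('k::field \<Rightarrow> 'a::ab_group_add \<Rightarrow> 'a) \<Rightarrow> ('k \<Rightarrow> 'b::ab_group_add \<Rightarrow> 'b) \<Rightarrow>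
     ('k \<Rightarrow> 'c::ab_group_add \<Rightarrow> 'c) \<Rightarrow> ('a \<Rightarrow> 'b \<Rightarrow> 'c) \<Rightarrow> bool"
  where "bilinear_map sA sB sC f \<longleftrightarrow>
    (\<forall>x. Vector_Spaces.linear sB sC (\<lambda>y. f x y)) \<and> (\<forall>y. Vector_Spaces.linear sA sC (\<lambda>x. f x y))"

definition trilinear_map ::
    "('k::field \<Rightarrow> 'a::ab_group_add \<Rightarrow> 'a) \<Rightarrow> ('k \<Rightarrow> 'b::ab_group_add \<Rightarrow> 'b) \<Rightarrow>
     ('k \<Rightarrow> 'c::ab_group_add \<Rightarrow> 'c) \<Rightarrow> ('k \<Rightarrow> 'd::ab_group_add \<Rightarrow> 'd) \<Rightarrow>
     ('a \<Rightarrow> 'b \<Rightarrow> 'c \<Rightarrow> 'd) \<Rightarrow> bool"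
  where "trilinear_map sA sB sC sD f \<longleftrightarrow>
    (\<forall>x y. Vector_Spaces.linear sC sD (\<lambda>z. f x y z)) \<and>
    (\<forall>x z. Vector_Spaces.linear sB sD (\<lambda>y. f x y z)) \<and>
    (\<forall>y z. Vector_Spaces.linear sA sD (\<lambda>x. f x y z))"

text \<open>
  The tensor product of the vector spaces \<open>A\<close> and \<open>B\<close> is realised inside the dual of the space of
  bilinear forms on \<open>A \<times> B\<close>: the pure tensor of \<open>x\<close> and \<open>y\<close> is evaluation at \<open>(x, y)\<close>, and the
  tensor product is the span of the pure tensors. Pure tensors send arguments that are not bilinear
  forms to \<open>0\<close>, so that equality of tensors only depends on bilinear forms. The lemmas below
  (\<open>bilinear_map_tensor\<close>, \<open>tensor_space_decomposition\<close>, \<open>tensor_lift_unique\<close>) are the universal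
  property.
\<close>

type_synonym ('a, 'b, 'k) tensor2 = "('a \<Rightarrow> 'b \<Rightarrow> 'k) \<Rightarrow> 'k"
type_synonym ('a, 'b, 'c, 'k) tensor3 = "('a \<Rightarrow> 'b \<Rightarrow> 'c \<Rightarrow> 'k) \<Rightarrow> 'k"

definition tensor_scale :: "'k::field \<Rightarrow> ('i \<Rightarrow> 'k) \<Rightarrow> ('i \<Rightarrow> 'k)"
  where "tensor_scale c t = (\<lambda>\<beta>. c * t \<beta>)"

definition tensor ::
    "('k::field \<Rightarrow> 'a::ab_group_add \<Rightarrow> 'a) \<Rightarrow> ('k \<Rightarrow> 'b::ab_group_add \<Rightarrow> 'b) \<Rightarrow>
     'a \<Rightarrow> 'b \<Rightarrow> ('a, 'b, 'k) tensor2"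
  where "tensor sA sB x y = (\<lambda>\<beta>. if bilinear_map sA sB (*) \<beta> then \<beta> x y else 0)"

definition tensor3 ::
    "('k::field \<Rightarrow> 'a::ab_group_add \<Rightarrow> 'a) \<Rightarrow> ('k \<Rightarrow> 'b::ab_group_add \<Rightarrow> 'b) \<Rightarrow>
     ('k \<Rightarrow> 'c::ab_group_add \<Rightarrow> 'c) \<Rightarrow> 'a \<Rightarrow> 'b \<Rightarrow> 'c \<Rightarrow> ('a, 'b, 'c, 'k) tensor3"
  where "tensor3 sA sB sC x y z = (\<lambda>\<tau>. if trilinear_map sA sB sC (*) \<tau> then \<tau> x y z else 0)"

definition tensor_space ::
    "('k::field \<Rightarrow> 'a::ab_group_add \<Rightarrow> 'a) \<Rightarrow> ('k \<Rightarrow> 'b::ab_group_add \<Rightarrow> 'b) \<Rightarrow>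
     ('a, 'b, 'k) tensor2 set"
  where "tensor_space sA sB = module.span tensor_scale {tensor sA sB x y | x y. True}"

text \<open>
  Sweedler notation: for \<open>t\<close> in the tensor product, written \<open>t = t' \<otimes> t''\<close> with summation understood,
  \<open>sweedler sA sB t f\<close> is the sum \<open>f(t', t'')\<close>. By \<open>sweedler_eq\<close> the value does not depend on
  the chosen decomposition when \<open>f\<close> is bilinear.
\<close>

definition sweedler ::
    "('k::field \<Rightarrow> 'a::ab_group_add \<Rightarrow> 'a) \<Rightarrow> ('k \<Rightarrow> 'b::ab_group_add \<Rightarrow> 'b) \<Rightarrow>
     ('a, 'b, 'k) tensor2 \<Rightarrow> ('a \<Rightarrow> 'b \<Rightarrow> 'c::ab_group_add) \<Rightarrow> 'c"
  where "sweedler sA sB t f =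
    (\<Sum>(x, y)\<leftarrow>(SOME ps. t = (\<Sum>(x, y)\<leftarrow>ps. tensor sA sB x y)). f x y)"

definition tensor_mult ::
    "('k::field \<Rightarrow> 'a::ab_group_add \<Rightarrow> 'a) \<Rightarrow> ('k \<Rightarrow> 'b::ab_group_add \<Rightarrow> 'b) \<Rightarrow>
     ('a \<Rightarrow> 'a \<Rightarrow> 'a) \<Rightarrow> ('b \<Rightarrow> 'b \<Rightarrow> 'b) \<Rightarrow>
     ('a, 'b, 'k) tensor2 \<Rightarrow> ('a, 'b, 'k) tensor2 \<Rightarrow> ('a, 'b, 'k) tensor2"
  where "tensor_mult sA sB mA mB t u =
    sweedler sA sB t (\<lambda>a b. sweedler sA sB u (\<lambda>c d. tensor sA sB (mA a c) (mB b d)))"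

lemma vector_space_tensor_scale: "vector_space tensor_scale"
  by unfold_locales (auto simp: tensor_scale_def fun_eq_iff algebra_simps)

lemma vector_space_field: "vector_space ((*) :: 'k::field \<Rightarrow> 'k \<Rightarrow> 'k)"
  by unfold_locales (auto simp: algebra_simps)

lemma linearI:
  assumes "vector_space s1" "vector_space s2"
    and "\<And>x y. f (x + y) = f x + f y" "\<And>c x. f (s1 c x) = s2 c (f x)"
  shows "Vector_Spaces.linear s1 s2 f"
  using assms by (simp add: Vector_Spaces.linear_iff)

lemma linearD:
  assumes "Vector_Spaces.linear s1 s2 f"
  shows "f (x + y) = f x + f y" "f (s1 c x) = s2 c (f x)" "f 0 = 0"
    "vector_space s1" "vector_space s2"
proof -
  show add: "f (x + y) = f x + f y" for x y
    using assms by (simp add: Vector_Spaces.linear_iff)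
  show "f (s1 c x) = s2 c (f x)" "vector_space s1" "vector_space s2"
    using assms by (simp_all add: Vector_Spaces.linear_iff)
  show "f 0 = 0" using add[of 0 0] by simp
qed

lemma linear_comp:
  assumes "Vector_Spaces.linear s1 s2 f" "Vector_Spaces.linear s2 s3 g"
  shows "Vector_Spaces.linear s1 s3 (\<lambda>x. g (f x))"
  using assms by (simp add: Vector_Spaces.linear_iff)

lemma linear_sum_list:
  assumes "Vector_Spaces.linear s1 s2 f"
  shows "f (\<Sum>x\<leftarrow>xs. g x) = (\<Sum>x\<leftarrow>xs. f (g x))"
  by (induction xs) (simp_all add: linearD[OF assms])

lemma sum_list_fun_apply: "(\<Sum>x\<leftarrow>xs. g x) b = (\<Sum>x\<leftarrow>xs. g x b)"
  for g :: "'x \<Rightarrow> 'i \<Rightarrow> 'k::ab_group_add"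
  by (induction xs) simp_all

lemma bilinear_map_tensor:
  assumes "vector_space sA" "vector_space sB"
  shows "bilinear_map sA sB tensor_scale (tensor sA sB)"
  using assms vector_space_tensor_scale
  by (auto simp: tensor_def tensor_scale_def fun_eq_iff bilinear_map_def Vector_Spaces.linear_iff)

lemma tensor_space_decomposition:
  assumes "vector_space sA" "vector_space sB"
  shows "t \<in> tensor_space sA sB \<longleftrightarrow> (\<exists>ps. t = (\<Sum>(x, y)\<leftarrow>ps. tensor sA sB x y))"
proof -
  interpret T: vector_space "tensor_scale :: 'a \<Rightarrow> (('b \<Rightarrow> 'c \<Rightarrow> 'a) \<Rightarrow> 'a) \<Rightarrow> _"
    by (rule vector_space_tensor_scale)
  have lin: "tensor_scale c (tensor sA sB x y) = tensor sA sB (sA c x) y" for c x y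
    using bilinear_map_tensor[OF assms] unfolding bilinear_map_def
    by (metis linearD(2))
  show ?thesis
  proof
    assume "t \<in> tensor_space sA sB"
    then have "t \<in> T.span {tensor sA sB x y | x y. True}"
      by (simp add: tensor_space_def)
    then show "\<exists>ps. t = (\<Sum>(x, y)\<leftarrow>ps. tensor sA sB x y)"
    proof (induction rule: T.span_induct_alt)
      case base
      have "0 = (\<Sum>(x, y)\<leftarrow>[]. tensor sA sB x y)" by simp
      then show ?case by blast
    next
      case (step c v u)
      then obtain x y ps where "v = tensor sA sB x y" "u = (\<Sum>(x, y)\<leftarrow>ps. tensor sA sB x y)"
        by auto
      then have "tensor_scale c v + u = (\<Sum>(x, y)\<leftarrow>(sA c x, y) # ps. tensor sA sB x y)"
        by (simp add: lin)
      then show ?case by blast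
    qed
  next
    assume "\<exists>ps. t = (\<Sum>(x, y)\<leftarrow>ps. tensor sA sB x y)"
    then obtain ps where t: "t = (\<Sum>(x, y)\<leftarrow>ps. tensor sA sB x y)" by blast
    have "(\<Sum>(x, y)\<leftarrow>ps. tensor sA sB x y) \<in> T.span {tensor sA sB x y | x y. True}"
    proof (induction ps)
      case Nil
      show ?case unfolding list.map sum_list.Nil by (rule T.span_zero)
    next
      case (Cons p ps)
      have "tensor sA sB (fst p) (snd p) \<in> T.span {tensor sA sB x y | x y. True}"
        by (rule T.span_base) blast
      from T.span_add[OF this Cons.IH] show ?case
        unfolding list.map sum_list.Cons case_prod_unfold .
    qed
    then show "t \<in> tensor_space sA sB" by (simp add: t tensor_space_def)
  qed
qed

lemma linear_form_separating:
  assumes "vector_space sV" and "v \<noteq> 0"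
  shows "\<exists>\<phi>. Vector_Spaces.linear sV (*) \<phi> \<and> \<phi> v = 1"
proof -
  interpret p: vector_space_pair sV "(*)"
    using assms vector_space_field by (simp add: vector_space_pair_def)
  have "p.vs1.independent {v}" using \<open>v \<noteq> 0\<close> by simp
  from p.linear_independent_extend[OF this, of "\<lambda>_. 1"] show ?thesis by auto
qed

lemma linear_forms_eq:
  assumes "vector_space sV" and "\<And>\<phi>. Vector_Spaces.linear sV (*) \<phi> \<Longrightarrow> \<phi> v = \<phi> w"
  shows "v = w"
proof (rule ccontr)
  assume "v \<noteq> w"
  then obtain \<phi> where \<phi>: "Vector_Spaces.linear sV (*) \<phi>" "\<phi> (v - w) = 1"
    using linear_form_separating[OF assms(1), of "v - w"] by auto
  have "\<phi> (v - w) + \<phi> w = \<phi> v"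
    using linearD(1)[OF \<phi>(1), of "v - w" w] by simp
  with assms(2)[OF \<phi>(1)] \<phi>(2) show False by simp
qed

lemma tensor_lift_unique:
  assumes f: "bilinear_map sA sB sV f"
    and eq: "(\<Sum>(x, y)\<leftarrow>ps. tensor sA sB x y) = (\<Sum>(x, y)\<leftarrow>qs. tensor sA sB x y)"
  shows "(\<Sum>(x, y)\<leftarrow>ps. f x y) = (\<Sum>(x, y)\<leftarrow>qs. f x y)"
proof (rule linear_forms_eq)
  show "vector_space sV"
    using f linearD(5) unfolding bilinear_map_def by blast
next
  fix \<phi> assume \<phi>: "Vector_Spaces.linear sV (*) \<phi>"
  have b: "bilinear_map sA sB (*) (\<lambda>x y. \<phi> (f x y))"
    using f unfolding bilinear_map_def by (auto intro: linear_comp[OF _ \<phi>])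
  have "(\<Sum>p\<leftarrow>ps. tensor sA sB (fst p) (snd p)) (\<lambda>x y. \<phi> (f x y)) =
        (\<Sum>p\<leftarrow>qs. tensor sA sB (fst p) (snd p)) (\<lambda>x y. \<phi> (f x y))"
    using eq by (simp add: case_prod_unfold)
  then show "\<phi> (\<Sum>(x, y)\<leftarrow>ps. f x y) = \<phi> (\<Sum>(x, y)\<leftarrow>qs. f x y)"
    by (simp add: case_prod_unfold linear_sum_list[OF \<phi>] sum_list_fun_apply tensor_def b)
qed

lemma sweedler_eq:
  assumes "bilinear_map sA sB sV f" and t: "t = (\<Sum>(x, y)\<leftarrow>ps. tensor sA sB x y)"
  shows "sweedler sA sB t f = (\<Sum>(x, y)\<leftarrow>ps. f x y)"
proof -
  have "t = (\<Sum>(x, y)\<leftarrow>(SOME ps. t = (\<Sum>(x, y)\<leftarrow>ps. tensor sA sB x y)). tensor sA sB x y)"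
    using t by (rule someI)
  with t show ?thesis
    unfolding sweedler_def by (intro tensor_lift_unique[OF assms(1)]) simp
qed

lemma tensor3_lift_unique:
  assumes f: "trilinear_map sA sB sC sV f"
    and eq: "(\<Sum>(x, y, z)\<leftarrow>ps. tensor3 sA sB sC x y z) = (\<Sum>(x, y, z)\<leftarrow>qs. tensor3 sA sB sC x y z)"
  shows "(\<Sum>(x, y, z)\<leftarrow>ps. f x y z) = (\<Sum>(x, y, z)\<leftarrow>qs. f x y z)"
proof (rule linear_forms_eq)
  show "vector_space sV"
    using f linearD(5) unfolding trilinear_map_def by blast
next
  fix \<phi> assume \<phi>: "Vector_Spaces.linear sV (*) \<phi>"
  have b: "trilinear_map sA sB sC (*) (\<lambda>x y z. \<phi> (f x y z))"
    using f unfolding trilinear_map_def by (auto intro: linear_comp[OF _ \<phi>])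
  have "(\<Sum>p\<leftarrow>ps. tensor3 sA sB sC (fst p) (fst (snd p)) (snd (snd p))) (\<lambda>x y z. \<phi> (f x y z)) =
        (\<Sum>p\<leftarrow>qs. tensor3 sA sB sC (fst p) (fst (snd p)) (snd (snd p))) (\<lambda>x y z. \<phi> (f x y z))"
    using eq by (simp add: case_prod_unfold)
  then show "\<phi> (\<Sum>(x, y, z)\<leftarrow>ps. f x y z) = \<phi> (\<Sum>(x, y, z)\<leftarrow>qs. f x y z)"
    by (simp add: case_prod_unfold linear_sum_list[OF \<phi>] sum_list_fun_apply tensor3_def b)
qed


section \<open>Hopf algebras\<close>

locale k_algebra = vector_space scale
  for scale :: "'k::field \<Rightarrow> 'a::ab_group_add \<Rightarrow> 'a" +
  fixes mult :: "'a \<Rightarrow> 'a \<Rightarrow> 'a"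
    and one :: 'a
  assumes mult_bilinear: "bilinear_map scale scale scale mult"
    and mult_assoc: "mult (mult x y) z = mult x (mult y z)"
    and mult_one_left: "mult one x = x"
    and mult_one_right: "mult x one = x"

locale hopf_algebra = k_algebra scale mult one
  for scale :: "'k::field \<Rightarrow> 'h::ab_group_add \<Rightarrow> 'h"
    and mult :: "'h \<Rightarrow> 'h \<Rightarrow> 'h"
    and one :: 'h +
  fixes \<Delta> :: "'h \<Rightarrow> ('h, 'h, 'k) tensor2"
    and \<epsilon> :: "'h \<Rightarrow> 'k"
    and S :: "'h \<Rightarrow> 'h"
  assumes comult_linear: "Vector_Spaces.linear scale tensor_scale \<Delta>"
    and comult_in_tensor: "\<Delta> h \<in> tensor_space scale scale"
    and comult_coassoc:
      "sweedler scale scale (\<Delta> h) (\<lambda>a c. sweedler scale scale (\<Delta> a)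
          (\<lambda>a1 a2. tensor3 scale scale scale a1 a2 c)) =
       sweedler scale scale (\<Delta> h) (\<lambda>a c. sweedler scale scale (\<Delta> c)
          (\<lambda>c1 c2. tensor3 scale scale scale a c1 c2))"
    and counit_linear: "Vector_Spaces.linear scale (*) \<epsilon>"
    and counit_left: "sweedler scale scale (\<Delta> h) (\<lambda>h1 h2. scale (\<epsilon> h1) h2) = h"
    and counit_right: "sweedler scale scale (\<Delta> h) (\<lambda>h1 h2. scale (\<epsilon> h2) h1) = h"
    and comult_mult: "\<Delta> (mult g h) = tensor_mult scale scale mult mult (\<Delta> g) (\<Delta> h)"
    and comult_one: "\<Delta> one = tensor scale scale one one"
    and counit_mult: "\<epsilon> (mult g h) = \<epsilon> g * \<epsilon> h"
    and counit_one: "\<epsilon> one = 1"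
    and antipode_linear: "Vector_Spaces.linear scale scale S"
    and antipode_left: "sweedler scale scale (\<Delta> h) (\<lambda>h1 h2. mult (S h1) h2) = scale (\<epsilon> h) one"
    and antipode_right: "sweedler scale scale (\<Delta> h) (\<lambda>h1 h2. mult h1 (S h2)) = scale (\<epsilon> h) one"


section \<open>Yetter--Drinfeld module algebras\<close>

locale left_module_algebra =
  H: hopf_algebra sH mH oneH \<Delta> \<epsilon> S + X: k_algebra sX mX oneX
  for sH :: "'k::field \<Rightarrow> 'h::ab_group_add \<Rightarrow> 'h"
    and mH oneH \<Delta> \<epsilon> S
    and sX :: "'k \<Rightarrow> 'x::ab_group_add \<Rightarrow> 'x"
    and mX oneX +
  fixes act :: "'h \<Rightarrow> 'x \<Rightarrow> 'x"
  assumes act_bilinear: "bilinear_map sH sX sX act"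
    and act_mult: "act (mH g h) x = act g (act h x)"
    and act_one: "act oneH x = x"
    and act_product: "act h (mX x y) = sweedler sH sH (\<Delta> h) (\<lambda>h1 h2. mX (act h1 x) (act h2 y))"
    and act_unit: "act h oneX = sX (\<epsilon> h) oneX"

locale left_comodule_algebra =
  H: hopf_algebra sH mH oneH \<Delta> \<epsilon> S + X: k_algebra sX mX oneX
  for sH :: "'k::field \<Rightarrow> 'h::ab_group_add \<Rightarrow> 'h"
    and mH oneH \<Delta> \<epsilon> S
    and sX :: "'k \<Rightarrow> 'x::ab_group_add \<Rightarrow> 'x"
    and mX oneX +
  fixes \<delta> :: "'x \<Rightarrow> ('h, 'x, 'k) tensor2"
  assumes coact_linear: "Vector_Spaces.linear sX tensor_scale \<delta>"
    and coact_in_tensor: "\<delta> x \<in> tensor_space sH sX"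
    and coact_coassoc:
      "sweedler sH sX (\<delta> x) (\<lambda>u v. sweedler sH sH (\<Delta> u) (\<lambda>u1 u2. tensor3 sH sH sX u1 u2 v)) =
       sweedler sH sX (\<delta> x) (\<lambda>u v. sweedler sH sX (\<delta> v) (\<lambda>v1 v2. tensor3 sH sH sX u v1 v2))"
    and coact_counit: "sweedler sH sX (\<delta> x) (\<lambda>u v. sX (\<epsilon> u) v) = x"
    and coact_mult: "\<delta> (mX x y) = tensor_mult sH sX mH mX (\<delta> x) (\<delta> y)"
    and coact_one: "\<delta> oneX = tensor sH sX oneH oneX"

locale yetter_drinfeld_module_algebra =
  left_module_algebra sH mH oneH \<Delta> \<epsilon> S sX mX oneX act +
  left_comodule_algebra sH mH oneH \<Delta> \<epsilon> S sX mX oneX \<delta>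
  for sH :: "'k::field \<Rightarrow> 'h::ab_group_add \<Rightarrow> 'h"
    and mH oneH \<Delta> \<epsilon> S
    and sX :: "'k \<Rightarrow> 'x::ab_group_add \<Rightarrow> 'x"
    and mX oneX act \<delta> +
  assumes yetter_drinfeld:
    "sweedler sH sH (\<Delta> h) (\<lambda>h1 h2. sweedler sH sX (\<delta> (act h1 x))
        (\<lambda>u v. tensor sH sX (mH u h2) v)) =
     sweedler sH sH (\<Delta> h) (\<lambda>h1 h2. sweedler sH sX (\<delta> x)
        (\<lambda>u v. tensor sH sX (mH h1 u) (act h2 v)))"

definition braided_commutative ::
    "('k::field \<Rightarrow> 'h::ab_group_add \<Rightarrow> 'h) \<Rightarrow> ('k \<Rightarrow> 'x::ab_group_add \<Rightarrow> 'x) \<Rightarrow> ('x \<Rightarrow> 'x \<Rightarrow> 'x) \<Rightarrow>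
     ('h \<Rightarrow> 'x \<Rightarrow> 'x) \<Rightarrow> ('x \<Rightarrow> ('h, 'x, 'k) tensor2) \<Rightarrow> bool"
  where "braided_commutative sH sX mX act \<delta> \<longleftrightarrow>
    (\<forall>x y. mX y x = sweedler sH sX (\<delta> y) (\<lambda>u v. mX (act u x) v))"


section \<open>Right 2-cocycles and the twisted algebra\<close>

definition normal_right_2_cocycle ::
    "('k::field \<Rightarrow> 'h::ab_group_add \<Rightarrow> 'h) \<Rightarrow> ('h \<Rightarrow> 'h \<Rightarrow> 'h) \<Rightarrow> 'h \<Rightarrow>
     ('h \<Rightarrow> ('h, 'h, 'k) tensor2) \<Rightarrow> ('h \<Rightarrow> 'k) \<Rightarrow> ('h \<Rightarrow> 'h \<Rightarrow> 'k) \<Rightarrow> bool"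
  where "normal_right_2_cocycle scale mult one \<Delta> \<epsilon> \<eta> \<longleftrightarrow>
    bilinear_map scale scale (*) \<eta> \<and>
    (\<forall>f g h.
      sweedler scale scale (\<Delta> f) (\<lambda>f1 f2. sweedler scale scale (\<Delta> g) (\<lambda>g1 g2.
        \<eta> (mult f1 g1) h * \<eta> f2 g2)) =
      sweedler scale scale (\<Delta> g) (\<lambda>g1 g2. sweedler scale scale (\<Delta> h) (\<lambda>h1 h2.
        \<eta> f (mult g1 h1) * \<eta> g2 h2))) \<and>
    (\<forall>h. \<eta> one h = \<epsilon> h \<and> \<eta> h one = \<epsilon> h)"

definition star_mult ::
    "('k::field \<Rightarrow> 'h::ab_group_add \<Rightarrow> 'h) \<Rightarrow> ('h \<Rightarrow> 'h \<Rightarrow> 'h) \<Rightarrow>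
     ('h \<Rightarrow> ('h, 'h, 'k) tensor2) \<Rightarrow> ('h \<Rightarrow> 'h \<Rightarrow> 'k) \<Rightarrow> 'h \<Rightarrow> 'h \<Rightarrow> 'h"
  where "star_mult scale mult \<Delta> \<eta> g h =
    sweedler scale scale (\<Delta> g) (\<lambda>g1 g2. sweedler scale scale (\<Delta> h) (\<lambda>h1 h2.
      scale (\<eta> g2 h2) (mult g1 h1)))"

definition twisted_antipode ::
    "('k::field \<Rightarrow> 'h::ab_group_add \<Rightarrow> 'h) \<Rightarrow> ('h \<Rightarrow> ('h, 'h, 'k) tensor2) \<Rightarrow> ('h \<Rightarrow> 'h) \<Rightarrow>
     ('h \<Rightarrow> 'h \<Rightarrow> 'k) \<Rightarrow> 'h \<Rightarrow> 'h"
  where "twisted_antipode scale \<Delta> S \<eta> h =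
    sweedler scale scale (\<Delta> h) (\<lambda>a h3. sweedler scale scale (\<Delta> a) (\<lambda>h1 h2.
      scale (\<eta> h1 h2) (S h3)))"

definition star_action ::
    "('k::field \<Rightarrow> 'h::ab_group_add \<Rightarrow> 'h) \<Rightarrow> ('h \<Rightarrow> 'h \<Rightarrow> 'h) \<Rightarrow>
     ('h \<Rightarrow> ('h, 'h, 'k) tensor2) \<Rightarrow> ('h \<Rightarrow> 'h) \<Rightarrow> ('h \<Rightarrow> 'h \<Rightarrow> 'k) \<Rightarrow> 'h \<Rightarrow> 'h \<Rightarrow> 'h"
  where "star_action scale mult \<Delta> S \<eta> g h =
    sweedler scale scale (\<Delta> g) (\<lambda>g1 g2.
      star_mult scale mult \<Delta> \<eta> (star_mult scale mult \<Delta> \<eta> g1 h)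
        (twisted_antipode scale \<Delta> S \<eta> g2))"

end

theory Submission
  imports Defs
begin

text \<open>
  The coproduct is multiplicative for the star product, and \<open>\<Delta>(s(h)) = S(h'') \<otimes> s(h')\<close>. With the
  first two conditions on \<open>\<eta>\<close> this makes \<open>s\<close> a two-sided convolution inverse of the identity for
  the star product, and the third condition says \<open>s(g h) = \<eta>(g', h') s(h'') \<star> s(g'')\<close>. Hence
  \<open>g \<triangleright> h = g' \<star> h \<star> s(g'')\<close> behaves like the adjoint action of a Hopf algebra on itself: the
  cocycle in \<open>s(g h)\<close> is absorbed by \<open>g' h' \<eta>(g'', h'') = g \<star> h\<close>, and braided commutativity is
  the cancellation \<open>y' \<star> x \<star> s(y'') \<star> y''' = y \<star> x\<close>.
\<close>

section \<open>Multilinear calculus of Sweedler sums\<close>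

lemma sweedler_cong:
  assumes "\<And>x y. f x y = g x y"
  shows "sweedler sA sB t f = sweedler sA sB t g"
proof -
  have "f = g" using assms by (intro ext)
  then show ?thesis by simp
qed

text \<open>
  \<open>sweedler\<close> sums over one chosen decomposition of \<open>t\<close>, so manipulations of the integrand need no
  bilinearity; only changing the decomposition does.
\<close>

lemma sweedler_linear:
  assumes "Vector_Spaces.linear s1 s2 \<phi>"
  shows "\<phi> (sweedler sA sB t f) = sweedler sA sB t (\<lambda>x y. \<phi> (f x y))"
  by (simp add: sweedler_def case_prod_unfold linear_sum_list[OF assms])

text \<open>Both sides are finite list sums over decompositions fixed by \<open>t\<close> and
  \<open>u\<close> alone, so this is the interchange of two finite sums.\<close>

lemma sweedler_swap:
  "sweedler sA sB t (\<lambda>x y. sweedler sC sD u (\<lambda>z w. f x y z w)) =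
   sweedler sC sD u (\<lambda>z w. sweedler sA sB t (\<lambda>x y. f x y z w))"
proof -
  have "(\<Sum>p\<leftarrow>ps. \<Sum>q\<leftarrow>qs. g p q) = (\<Sum>q\<leftarrow>qs. \<Sum>p\<leftarrow>ps. g p q)"
    for ps :: "'x list" and qs :: "'y list" and g :: "'x \<Rightarrow> 'y \<Rightarrow> 'z::ab_group_add"
    by (induction ps) (simp_all add: sum_list_addf)
  then show ?thesis by (simp add: sweedler_def case_prod_unfold)
qed

text \<open>Here the variable occurs only in the integrand. The decomposition of \<open>t\<close>
  stays the same, so linearity can be checked summand by summand.\<close>

lemma linear_sweedler_integrand:
  assumes "vector_space s1" "vector_space s2"
    and "\<And>x y. Vector_Spaces.linear s1 s2 (\<lambda>z. f z x y)"
  shows "Vector_Spaces.linear s1 s2 (\<lambda>z. sweedler sA sB t (f z))"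
proof (rule linearI[OF assms(1,2)])
  interpret V: vector_space s2 by (rule assms(2))
  have add: "(\<Sum>p\<leftarrow>ps. f (z + w) (fst p) (snd p)) =
      (\<Sum>p\<leftarrow>ps. f z (fst p) (snd p)) + (\<Sum>p\<leftarrow>ps. f w (fst p) (snd p))" for ps z w
    by (induction ps) (simp_all add: linearD(1)[OF assms(3)])
  show "sweedler sA sB t (f (z + w)) = sweedler sA sB t (f z) + sweedler sA sB t (f w)" for z w
    by (simp add: sweedler_def case_prod_unfold add)
  have scl: "(\<Sum>p\<leftarrow>ps. f (s1 c z) (fst p) (snd p)) = s2 c (\<Sum>p\<leftarrow>ps. f z (fst p) (snd p))" for ps c z
    by (induction ps) (simp_all add: linearD(2)[OF assms(3)] V.scale_right_distrib)
  show "sweedler sA sB t (f (s1 c z)) = s2 c (sweedler sA sB t (f z))" for c z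
    by (simp add: sweedler_def case_prod_unfold scl)
qed

text \<open>Membership in the tensor space is what makes the list chosen by \<open>sweedler\<close>
  a genuine decomposition of \<open>t\<close>.\<close>

lemma sweedler_decomposition:
  assumes "vector_space sA" "vector_space sB" "t \<in> tensor_space sA sB"
  shows "sweedler sA sB t (tensor sA sB) = t"
proof -
  from tensor_space_decomposition[OF assms(1,2)] assms(3)
  have "\<exists>ps. t = (\<Sum>(x, y)\<leftarrow>ps. tensor sA sB x y)" by blast
  from someI_ex[OF this] show ?thesis by (simp add: sweedler_def)
qed

lemma bilinear_mapI:
  assumes "\<And>y. Vector_Spaces.linear sA sC (\<lambda>x. f x y)" "\<And>x. Vector_Spaces.linear sB sC (f x)"
  shows "bilinear_map sA sB sC f"
  using assms by (simp add: bilinear_map_def)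

lemma bilinear_mapD:
  assumes "bilinear_map sA sB sC f"
  shows "Vector_Spaces.linear sA sC (\<lambda>x. f x y)" "Vector_Spaces.linear sB sC (f x)"
  using assms by (simp_all add: bilinear_map_def)

lemma linear_same_argument:
  assumes "vector_space s" shows "Vector_Spaces.linear s s (\<lambda>x. x)"
  using assms by (rule linearI[OF _ assms]) auto

lemma linear_scaled_coefficient:
  assumes "vector_space sV" "Vector_Spaces.linear s (*) \<phi>"
  shows "Vector_Spaces.linear s sV (\<lambda>x. sV (\<phi> x) v)"
proof -
  interpret V: vector_space sV by (rule assms(1))
  show ?thesis
    by (rule linearI[OF linearD(4)[OF assms(2)] assms(1)])
      (simp_all add: linearD[OF assms(2)] V.scale_left_distrib)
qed

lemma linear_scaled_vector:
  assumes "vector_space sV" "Vector_Spaces.linear s sV f"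
  shows "Vector_Spaces.linear s sV (\<lambda>x. sV c (f x))"
proof -
  interpret V: vector_space sV by (rule assms(1))
  show ?thesis
    by (rule linearI[OF linearD(4)[OF assms(2)] assms(1)])
      (simp_all add: linearD[OF assms(2)] V.scale_right_distrib mult.commute)
qed

text \<open>The variable now sits in the tensor, and the lists chosen for \<open>g (x + y)\<close>,
  \<open>g x\<close> and \<open>g y\<close> are unrelated. Concatenating lists, or scaling their
  first entries, gives other decompositions, and bilinearity of \<open>f\<close> makes the choice
  irrelevant.\<close>

lemma sweedler_linear_tensor:
  assumes A: "vector_space sA" and B: "vector_space sB" and f: "bilinear_map sA sB sV f"
    and g: "Vector_Spaces.linear s1 tensor_scale g" and range: "\<And>x. g x \<in> tensor_space sA sB"
  shows "Vector_Spaces.linear s1 sV (\<lambda>x. sweedler sA sB (g x) f)"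
proof (rule linearI)
  show "vector_space s1" by (rule linearD(4)[OF g])
  show V: "vector_space sV" using f linearD(5) unfolding bilinear_map_def by blast
  interpret V: vector_space sV by (rule V)
  have dec: "\<exists>ps. g x = (\<Sum>(x, y)\<leftarrow>ps. tensor sA sB x y)" for x
    using range tensor_space_decomposition[OF A B] by blast
  show "sweedler sA sB (g (x + y)) f = sweedler sA sB (g x) f + sweedler sA sB (g y) f" for x y
  proof -
    obtain ps qs where ps: "g x = (\<Sum>(x, y)\<leftarrow>ps. tensor sA sB x y)"
      and qs: "g y = (\<Sum>(x, y)\<leftarrow>qs. tensor sA sB x y)"
      using dec by meson
    then have "g (x + y) = (\<Sum>(x, y)\<leftarrow>ps @ qs. tensor sA sB x y)"
      by (simp add: linearD(1)[OF g])
    from sweedler_eq[OF f this] show ?thesis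
      by (simp add: sweedler_eq[OF f ps] sweedler_eq[OF f qs])
  qed
  show "sweedler sA sB (g (s1 c x)) f = sV c (sweedler sA sB (g x) f)" for c x
  proof -
    obtain ps where ps: "g x = (\<Sum>(x, y)\<leftarrow>ps. tensor sA sB x y)"
      using dec by meson
    have T: "Vector_Spaces.linear sA tensor_scale (\<lambda>x. tensor sA sB x y)" for y
      using bilinear_map_tensor[OF A B] by (rule bilinear_mapD)
    have "Vector_Spaces.linear tensor_scale tensor_scale
        (\<lambda>t :: ('b, 'c, 'a) tensor2. tensor_scale c t)"
      by (intro linear_scaled_vector linear_same_argument vector_space_tensor_scale)
    from linear_sum_list[OF this]
    have "tensor_scale c (\<Sum>(x, y)\<leftarrow>ps. tensor sA sB x y) =
        (\<Sum>(x, y)\<leftarrow>map (\<lambda>(x, y). (sA c x, y)) ps. tensor sA sB x y)"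
      by (simp add: case_prod_unfold o_def linearD(2)[OF T])
    then have "g (s1 c x) = (\<Sum>(x, y)\<leftarrow>map (\<lambda>(x, y). (sA c x, y)) ps. tensor sA sB x y)"
      by (simp add: linearD(2)[OF g] ps)
    then have "sweedler sA sB (g (s1 c x)) f =
        (\<Sum>(x, y)\<leftarrow>map (\<lambda>(x, y). (sA c x, y)) ps. f x y)"
      by (rule sweedler_eq[OF f])
    also have "\<dots> = sV c (\<Sum>(x, y)\<leftarrow>ps. f x y)"
      by (induction ps)
        (auto simp: V.scale_right_distrib linearD(2)[OF bilinear_mapD(1)[OF f]])
    finally show ?thesis by (simp add: sweedler_eq[OF f ps])
  qed
qed

lemma sweedler_tensor:
  assumes "bilinear_map sA sB sV f"
  shows "sweedler sA sB (tensor sA sB x y) f = f x y"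
proof -
  have "tensor sA sB x y = (\<Sum>(x, y)\<leftarrow>[(x, y)]. tensor sA sB x y)" by simp
  from sweedler_eq[OF assms this] show ?thesis by simp
qed


section \<open>Sweedler calculus in a Hopf algebra\<close>

context hopf_algebra
begin

abbreviation times (infixl "\<cdot>" 70)
  where "x \<cdot> y \<equiv> mult x y"

abbreviation sw :: "'h \<Rightarrow> ('h \<Rightarrow> 'h \<Rightarrow> 'c::ab_group_add) \<Rightarrow> 'c"
  where "sw h f \<equiv> sweedler scale scale (\<Delta> h) f"

abbreviation lin :: "('k \<Rightarrow> 'c::ab_group_add \<Rightarrow> 'c) \<Rightarrow> ('h \<Rightarrow> 'c) \<Rightarrow> bool"
  where "lin sV f \<equiv> Vector_Spaces.linear scale sV f"

lemma vs: "vector_space scale" by unfold_locales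

lemma lin_mult_left: "lin scale f \<Longrightarrow> lin scale (\<lambda>x. f x \<cdot> b)"
  by (rule linear_comp[OF _ bilinear_mapD(1)[OF mult_bilinear]])

lemma lin_mult_right: "lin scale f \<Longrightarrow> lin scale (\<lambda>x. b \<cdot> f x)"
  by (rule linear_comp[OF _ bilinear_mapD(2)[OF mult_bilinear]])

lemma lin_antipode: "lin scale f \<Longrightarrow> lin scale (\<lambda>x. S (f x))"
  by (rule linear_comp[OF _ antipode_linear])

lemma lin_counit: "lin scale f \<Longrightarrow> lin (*) (\<lambda>x. \<epsilon> (f x))"
  by (rule linear_comp[OF _ counit_linear])

lemma lin_sw_argument:
  assumes "lin scale g" "\<And>b. lin sV (\<lambda>a. F a b)" "\<And>a. lin sV (F a)"
  shows "lin sV (\<lambda>x. sw (g x) F)"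
proof (rule linear_comp[OF assms(1)])
  show "lin sV (\<lambda>x. sw x F)"
    by (intro sweedler_linear_tensor[OF vs vs _ comult_linear comult_in_tensor]
        bilinear_mapI assms)
qed

lemma lin_sw_integrand:
  assumes "\<And>a b. lin sV (\<lambda>x. F x a b)"
  shows "lin sV (\<lambda>x. sw h (F x))"
  by (rule linear_sweedler_integrand[OF vs linearD(5)[OF assms] assms])

lemma lin_tensor_left: "lin scale f \<Longrightarrow> lin tensor_scale (\<lambda>x. tensor scale scale (f x) b)"
  by (rule linear_comp[OF _ bilinear_mapD(1)[OF bilinear_map_tensor[OF vs vs]]])

lemma lin_tensor_right: "lin scale f \<Longrightarrow> lin tensor_scale (\<lambda>x. tensor scale scale b (f x))"
  by (rule linear_comp[OF _ bilinear_mapD(2)[OF bilinear_map_tensor[OF vs vs]]])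

lemmas lin_scale_left = linear_scaled_coefficient[where s = scale]
lemmas lin_scale_right = linear_scaled_vector[where s = scale]

text \<open>Each rule speaks of a composite argument \<open>f x\<close>, so backward chaining
  follows the syntax of an expression and proves it linear in one chosen variable. This discharges
  the side conditions of the Sweedler rules.\<close>

lemmas lin_intros = linear_same_argument[OF vs] lin_mult_left lin_mult_right lin_antipode lin_counit
  lin_sw_argument lin_sw_integrand lin_tensor_left lin_tensor_right
  lin_scale_left[OF vs] lin_scale_right[OF vs]
  lin_scale_left[OF vector_space_field] lin_scale_right[OF vector_space_field]

lemma lin_arg: "lin sV F \<Longrightarrow> lin scale f \<Longrightarrow> lin sV (\<lambda>x. F (f x))"
  by (rule linear_comp)

lemma comult_sw: "\<Delta> h = sw h (tensor scale scale)"
  by (simp add: sweedler_decomposition[OF vs vs comult_in_tensor])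

lemma sw_tensor:
  assumes "\<And>b. lin sV (\<lambda>a. F a b)" "\<And>a. lin sV (F a)"
  shows "sweedler scale scale (tensor scale scale x y) F = F x y"
  by (rule sweedler_tensor[OF bilinear_mapI]) (rule assms)+

lemma sw_one:
  assumes "\<And>b. lin sV (\<lambda>a. F a b)" "\<And>a. lin sV (F a)"
  shows "sw one F = F one one"
  unfolding comult_one using assms by (rule sw_tensor)

text \<open>Multiplicativity of \<open>\<Delta>\<close>, tested against an arbitrary bilinear
  \<open>F\<close>: products of the terms decomposing \<open>\<Delta> g\<close> and
  \<open>\<Delta> h\<close> decompose \<open>\<Delta> (g \<cdot> h)\<close>.\<close>

lemma sw_mult:
  assumes F: "\<And>b. lin sV (\<lambda>a. F a b)" "\<And>a. lin sV (F a)"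
  shows "sw (g \<cdot> h) F = sw g (\<lambda>g1 g2. sw h (\<lambda>h1 h2. F (g1 \<cdot> h1) (g2 \<cdot> h2)))"
proof -
  obtain ps where ps: "\<Delta> g = (\<Sum>(x, y)\<leftarrow>ps. tensor scale scale x y)"
    using comult_in_tensor tensor_space_decomposition[OF vs vs] by blast
  obtain qs where qs: "\<Delta> h = (\<Sum>(x, y)\<leftarrow>qs. tensor scale scale x y)"
    using comult_in_tensor tensor_space_decomposition[OF vs vs] by blast
  have q: "sw h G = (\<Sum>(x, y)\<leftarrow>qs. G x y)"
    if "\<And>b. lin sW (\<lambda>a. G a b)" "\<And>a. lin sW (G a)" for sW and G :: "'h \<Rightarrow> 'h \<Rightarrow> 'd::ab_group_add"
    by (rule sweedler_eq[OF bilinear_mapI qs]) (rule that)+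
  have p: "sw g G = (\<Sum>(x, y)\<leftarrow>ps. G x y)"
    if "\<And>b. lin sW (\<lambda>a. G a b)" "\<And>a. lin sW (G a)" for sW and G :: "'h \<Rightarrow> 'h \<Rightarrow> 'd::ab_group_add"
    by (rule sweedler_eq[OF bilinear_mapI ps]) (rule that)+
  have FL: "lin sV (\<lambda>x. F (f x) y)" if "lin scale f" for f y
    by (rule linear_comp[OF that F(1)])
  have FR: "lin sV (\<lambda>x. F y (f x))" if "lin scale f" for f y
    by (rule linear_comp[OF that F(2)])
  have "\<Delta> (g \<cdot> h) = sw g (\<lambda>a b. sw h (\<lambda>c d. tensor scale scale (a \<cdot> c) (b \<cdot> d)))"
    by (simp add: comult_mult tensor_mult_def)
  also have "\<dots> = (\<Sum>(a, b)\<leftarrow>ps. sw h (\<lambda>c d. tensor scale scale (a \<cdot> c) (b \<cdot> d)))"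
    by (rule p[of tensor_scale]; intro lin_intros)
  also have "\<dots> = (\<Sum>(a, b)\<leftarrow>ps. \<Sum>(c, d)\<leftarrow>qs. tensor scale scale (a \<cdot> c) (b \<cdot> d))"
    by (subst q[of tensor_scale]) (intro lin_intros refl)+
  \<comment> \<open>Flattening the double sum exhibits one list of pairs decomposing
    \<open>\<Delta> (g \<cdot> h)\<close>, the form that \<open>sweedler_eq\<close>
    requires.\<close>
  also have "\<dots> = (\<Sum>(x, y)\<leftarrow>concat (map (\<lambda>(a, b). map (\<lambda>(c, d). (a \<cdot> c, b \<cdot> d)) qs) ps).
      tensor scale scale x y)"
    by (induction ps) (auto simp: case_prod_unfold o_def)
  finally have "sw (g \<cdot> h) F =
      (\<Sum>(x, y)\<leftarrow>concat (map (\<lambda>(a, b). map (\<lambda>(c, d). (a \<cdot> c, b \<cdot> d)) qs) ps). F x y)"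
    by (rule sweedler_eq[OF bilinear_mapI[OF F]])
  also have "\<dots> = (\<Sum>(a, b)\<leftarrow>ps. \<Sum>(c, d)\<leftarrow>qs. F (a \<cdot> c) (b \<cdot> d))"
    by (induction ps) (auto simp: case_prod_unfold o_def)
  also have "\<dots> = (\<Sum>(a, b)\<leftarrow>ps. sw h (\<lambda>c d. F (a \<cdot> c) (b \<cdot> d)))"
    by (subst q[of sV]) (intro lin_intros FL FR refl)+
  also have "\<dots> = sw g (\<lambda>a b. sw h (\<lambda>c d. F (a \<cdot> c) (b \<cdot> d)))"
    by (rule p[of sV, symmetric]; intro lin_intros FL FR)
  finally show ?thesis .
qed

text \<open>Coassociativity is assumed only for the values of \<open>tensor3\<close>; the universal
  property of the triple tensor product carries it to every trilinear \<open>f\<close>.\<close>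

lemma sw_coassoc:
  assumes f: "\<And>y z. lin sV (\<lambda>x. f x y z)" "\<And>x z. lin sV (\<lambda>y. f x y z)" "\<And>x y. lin sV (f x y)"
  shows "sw h (\<lambda>a c. sw a (\<lambda>a1 a2. f a1 a2 c)) = sw h (\<lambda>a c. sw c (f a))"
proof -
  \<comment> \<open>\<open>D\<close> names the list selected by \<open>sweedler\<close>, while
    \<open>L\<close> and \<open>R\<close> flatten the two iterated coproducts into lists of
    triples.\<close>
  define D where "D h = (SOME ps. \<Delta> h = (\<Sum>(x, y)\<leftarrow>ps. tensor scale scale x y))" for h
  have D: "sw h F = (\<Sum>(x, y)\<leftarrow>D h. F x y)" for h and F :: "'h \<Rightarrow> 'h \<Rightarrow> 'd::ab_group_add"
    by (simp add: sweedler_def D_def)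
  define L where "L ps = concat (map (\<lambda>(a, c). map (\<lambda>(a1, a2). (a1, a2, c)) (D a)) ps)"
    for ps :: "('h \<times> 'h) list"
  define R where "R ps = concat (map (\<lambda>(a, c). map (\<lambda>(c1, c2). (a, c1, c2)) (D c)) ps)"
    for ps :: "('h \<times> 'h) list"
  have L: "(\<Sum>(a, c)\<leftarrow>ps. sw a (\<lambda>a1 a2. F a1 a2 c)) = (\<Sum>(x, y, z)\<leftarrow>L ps. F x y z)"
    and R: "(\<Sum>(a, c)\<leftarrow>ps. sw c (F a)) = (\<Sum>(x, y, z)\<leftarrow>R ps. F x y z)"
    for ps and F :: "'h \<Rightarrow> 'h \<Rightarrow> 'h \<Rightarrow> 'd::ab_group_add"
    unfolding D by (induction ps) (auto simp: case_prod_unfold o_def L_def R_def)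
  have "trilinear_map scale scale scale sV f"
    unfolding trilinear_map_def using f by blast
  moreover have "(\<Sum>(x, y, z)\<leftarrow>L (D h). tensor3 scale scale scale x y z) =
      (\<Sum>(x, y, z)\<leftarrow>R (D h). tensor3 scale scale scale x y z)"
    using comult_coassoc[of h] unfolding D[of h] L R .
  ultimately show ?thesis
    unfolding D[of h] L R by (rule tensor3_lift_unique)
qed

text \<open>Coassociativity in two elements at once, for formulas that pair the components of
  \<open>g\<close> with those of \<open>h\<close>.\<close>

lemma sw_coassoc2:
  assumes f: "\<And>b c x y z. lin sV (\<lambda>a. f a b c x y z)" "\<And>a c x y z. lin sV (\<lambda>b. f a b c x y z)"
    "\<And>a b x y z. lin sV (\<lambda>c. f a b c x y z)" "\<And>a b c y z. lin sV (\<lambda>x. f a b c x y z)"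
    "\<And>a b c x z. lin sV (\<lambda>y. f a b c x y z)" "\<And>a b c x y. lin sV (\<lambda>z. f a b c x y z)"
  shows "sw g (\<lambda>p c. sw h (\<lambda>q z. sw p (\<lambda>a b. sw q (\<lambda>x y. f a b c x y z)))) =
    sw g (\<lambda>a r. sw h (\<lambda>x t. sw r (\<lambda>b c. sw t (\<lambda>y z. f a b c x y z))))"
proof -
  have "sw g (\<lambda>p c. sw h (\<lambda>q z. sw p (\<lambda>a b. sw q (\<lambda>x y. f a b c x y z)))) =
    sw g (\<lambda>p c. sw p (\<lambda>a b. sw h (\<lambda>q z. sw q (\<lambda>x y. f a b c x y z))))"
    by (rule sweedler_swap | rule sweedler_cong)+
  \<comment> \<open>\<open>sweedler_cong\<close> peels off outer sums until coassociativity applies,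
    leaving linearity goals. \<open>sV\<close> occurs only in those goals and must be given
    explicitly.\<close>
  also have "\<dots> = sw g (\<lambda>p c. sw p (\<lambda>a b. sw h (\<lambda>x t. sw t (\<lambda>y z. f a b c x y z))))"
    by ((rule sw_coassoc[where sV = sV] | rule sweedler_cong)+; intro f)
  also have "\<dots> = sw g (\<lambda>a r. sw r (\<lambda>b c. sw h (\<lambda>x t. sw t (\<lambda>y z. f a b c x y z))))"
    by (rule sw_coassoc[where sV = sV]; intro lin_intros f)
  also have "\<dots> = sw g (\<lambda>a r. sw h (\<lambda>x t. sw r (\<lambda>b c. sw t (\<lambda>y z. f a b c x y z))))"
    by (rule sweedler_swap | rule sweedler_cong)+
  finally show ?thesis .
qed

text \<open>Balanced bracketing of four components becomes right-nested, which brings the two middle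
  ones next to each other for cancellation.\<close>

lemma sw_coassoc_middle:
  assumes f: "\<And>b c d. lin sV (\<lambda>a. f a b c d)" "\<And>a c d. lin sV (\<lambda>b. f a b c d)"
    "\<And>a b d. lin sV (\<lambda>c. f a b c d)" "\<And>a b c. lin sV (\<lambda>d. f a b c d)"
  shows "sw h (\<lambda>p q. sw p (\<lambda>a b. sw q (\<lambda>c d. f a b c d))) =
    sw h (\<lambda>a r. sw r (\<lambda>b q. sw q (\<lambda>c d. f a b c d)))"
  by (rule sw_coassoc[where sV = sV]; intro lin_intros f)

section \<open>Counit and cancellation rules\<close>

lemma sw_counit_left:
  assumes "lin sV g" shows "sw h (\<lambda>a b. sV (\<epsilon> a) (g b)) = g h"
  using sweedler_linear[OF assms, of scale scale "\<Delta> h" "\<lambda>a b. scale (\<epsilon> a) b"]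
  by (simp add: counit_left linearD(2)[OF assms])

lemma sw_counit_right:
  assumes "lin sV g" shows "sw h (\<lambda>a b. sV (\<epsilon> b) (g a)) = g h"
  using sweedler_linear[OF assms, of scale scale "\<Delta> h" "\<lambda>a b. scale (\<epsilon> b) a"]
  by (simp add: counit_right linearD(2)[OF assms])

text \<open>The common form of the antipode laws for \<open>S\<close> with the original product and
  for \<open>s\<close> with the star product, so that one set of cancellation rules serves all
  four.\<close>

definition convolves_to_unit :: "('h \<Rightarrow> 'h \<Rightarrow> 'h) \<Rightarrow> bool"
  where "convolves_to_unit m \<longleftrightarrow> (\<forall>x. lin scale (m x)) \<and> (\<forall>y. lin scale (\<lambda>x. m x y)) \<and>
    (\<forall>h. sw h m = scale (\<epsilon> h) one)"

lemma sw_cancel: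
  assumes m: "convolves_to_unit m" and g: "lin sV g"
  shows "sw h (\<lambda>a b. g (m a b)) = sV (\<epsilon> h) (g one)"
  using m sweedler_linear[OF g, of scale scale "\<Delta> h" m]
  by (simp add: convolves_to_unit_def linearD(2)[OF g])

text \<open>Reassociating makes \<open>a\<close> and \<open>b\<close> the two components of a single
  factor; \<open>m\<close> turns this factor into its counit, which the counit law removes.\<close>

lemma sw_cancel_first:
  assumes m: "convolves_to_unit m" and f: "\<And>b. lin sV (\<lambda>a. f a b)" "\<And>a. lin sV (f a)"
  shows "sw h (\<lambda>a r. sw r (\<lambda>b c. f (m a b) c)) = f one h"
proof -
  have "sw h (\<lambda>a r. sw r (\<lambda>b c. f (m a b) c)) = sw h (\<lambda>p c. sw p (\<lambda>a b. f (m a b) c))"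
    using m unfolding convolves_to_unit_def
    by (intro sw_coassoc[where sV = sV, symmetric] f lin_arg[OF f(1)]) blast+
  also have "\<dots> = sw h (\<lambda>p c. sV (\<epsilon> p) (f one c))"
    by (intro sweedler_cong sw_cancel[OF m] f)
  also have "\<dots> = f one h" by (rule sw_counit_left[OF f(2)])
  finally show ?thesis .
qed

lemma sw_cancel_last:
  assumes m: "convolves_to_unit m" and f: "\<And>b. lin sV (\<lambda>a. f a b)" "\<And>a. lin sV (f a)"
  shows "sw h (\<lambda>a r. sw r (\<lambda>b c. f a (m b c))) = f h one"
proof -
  have "sw h (\<lambda>a r. sw r (\<lambda>b c. f a (m b c))) = sw h (\<lambda>a r. sV (\<epsilon> r) (f a one))"
    by (intro sweedler_cong sw_cancel[OF m] f)
  also have "\<dots> = f h one" by (rule sw_counit_right[OF f(1)])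
  finally show ?thesis .
qed

lemma antipode_left_unit: "convolves_to_unit (\<lambda>a b. S a \<cdot> b)"
  unfolding convolves_to_unit_def by (intro conjI allI lin_intros antipode_left)

lemma antipode_right_unit: "convolves_to_unit (\<lambda>a b. a \<cdot> S b)"
  unfolding convolves_to_unit_def by (intro conjI allI lin_intros antipode_right)

section \<open>The antipode as an antihomomorphism\<close>

lemma antipode_one: "S one = one"
proof -
  have "sw one (\<lambda>a b. S a \<cdot> b) = S one \<cdot> one"
    by (rule sw_one[where sV = scale]; intro lin_intros)
  then show ?thesis by (simp add: antipode_left counit_one mult_one_right)
qed

text \<open>Uniqueness of convolution inverses: the two sides are a left and a right inverse of the
  multiplication map.\<close>

lemma antipode_mult: "S (g \<cdot> h) = S h \<cdot> S g"
proof -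
  \<comment> \<open>Both sides equal \<open>S(g' h') g'' h'' S(h''') S(g''')\<close>.\<close>
  let ?X = "sw g (\<lambda>a r. sw h (\<lambda>x t. sw r (\<lambda>b c. sw t (\<lambda>y z.
    S (a \<cdot> x) \<cdot> (b \<cdot> (y \<cdot> S z) \<cdot> S c)))))"
  have "?X = sw g (\<lambda>a r. sw h (\<lambda>x t. sw r (\<lambda>b c.
      scale (\<epsilon> t) (S (a \<cdot> x) \<cdot> (b \<cdot> one \<cdot> S c)))))"
    by ((rule sw_cancel[OF antipode_right_unit, where sV = scale and g = "\<lambda>w. S (a \<cdot> x) \<cdot> (b \<cdot> w \<cdot> S c)" for a b c x]
        | rule sweedler_cong)+; intro lin_intros)
  also have "\<dots> = sw g (\<lambda>a r. sw r (\<lambda>b c. sw h (\<lambda>x t.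
      scale (\<epsilon> t) (S (a \<cdot> x) \<cdot> (b \<cdot> S c)))))"
    unfolding mult_one_right by (rule sweedler_swap | rule sweedler_cong)+
  also have "\<dots> = sw g (\<lambda>a r. sw r (\<lambda>b c. S (a \<cdot> h) \<cdot> (b \<cdot> S c)))"
    by ((rule sw_counit_right[where sV = scale] | rule sweedler_cong)+; intro lin_intros)
  also have "\<dots> = S (g \<cdot> h) \<cdot> one"
    by (rule sw_cancel_last[OF antipode_right_unit, where sV = scale and f = "\<lambda>a w. S (a \<cdot> h) \<cdot> w"];
        intro lin_intros)
  finally have 1: "?X = S (g \<cdot> h)" by (simp add: mult_one_right)
  \<comment> \<open>The second evaluation puts the first two components of \<open>g\<close> and
    \<open>h\<close> under \<open>p\<close> and \<open>q\<close>, so that they form the coproduct of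
    \<open>p \<cdot> q\<close> and the left antipode law applies.\<close>
  have "?X = sw g (\<lambda>p c. sw h (\<lambda>q z. sw p (\<lambda>a b. sw q (\<lambda>x y.
      S (a \<cdot> x) \<cdot> (b \<cdot> (y \<cdot> S z) \<cdot> S c)))))"
    by (rule sw_coassoc2[where sV = scale, symmetric]; intro lin_intros)
  also have "\<dots> = sw g (\<lambda>p c. sw h (\<lambda>q z. sw (p \<cdot> q) (\<lambda>u v. (S u \<cdot> v) \<cdot> (S z \<cdot> S c))))"
    by (intro sweedler_cong, subst sw_mult[where sV = scale])
      (intro lin_intros, intro lin_intros, simp add: mult_assoc)
  also have "\<dots> = sw g (\<lambda>p c. sw h (\<lambda>q z. scale (\<epsilon> (p \<cdot> q)) (one \<cdot> (S z \<cdot> S c))))"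
    by ((rule sw_cancel[OF antipode_left_unit, where sV = scale and g = "\<lambda>w. w \<cdot> (S z \<cdot> S c)" for z c]
        | rule sweedler_cong)+; intro lin_intros)
  also have "\<dots> = sw g (\<lambda>p c. sw h (\<lambda>q z. scale (\<epsilon> q) (scale (\<epsilon> p) (S z \<cdot> S c))))"
    by (simp add: counit_mult mult_one_left mult.commute)
  also have "\<dots> = sw g (\<lambda>p c. scale (\<epsilon> p) (S h \<cdot> S c))"
    by ((rule sw_counit_left[where sV = scale] | rule sweedler_cong)+; intro lin_intros)
  also have "\<dots> = S h \<cdot> S g"
    by (rule sw_counit_left[where sV = scale]; intro lin_intros)
  finally show ?thesis using 1 by simp
qed

text \<open>This is \<open>\<Delta>(S(h)) = S(h'') \<otimes> S(h')\<close> tested against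
  \<open>F\<close>. Again inverses are compared: the two sides are a left and a right convolution
  inverse of \<open>\<Delta>\<close>.\<close>

lemma sw_antipode:
  assumes F: "\<And>b. lin sV (\<lambda>a. F a b)" "\<And>a. lin sV (F a)"
  shows "sw (S h) F = sw h (\<lambda>a b. F (S b) (S a))"
proof -
  have V: "vector_space sV" by (rule linearD(5)[OF F(2)])
  note li = lin_intros lin_arg[OF F(1)] lin_arg[OF F(2)] lin_scale_left[OF V] lin_scale_right[OF V]
  \<comment> \<open>Both sides equal \<open>\<Delta>(S(h1)) \<Delta>(h2) (S(h4) \<otimes> S(h3))\<close>, with \<open>F\<close> applied.\<close>
  let ?X = "sw h (\<lambda>a r. sw (S a) (\<lambda>p q. sw r (\<lambda>b r. sw r (\<lambda>c r. sw r (\<lambda>d e.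
      F (p \<cdot> (b \<cdot> S e)) (q \<cdot> (c \<cdot> S d)))))))"
  \<comment> \<open>The inner pair \<open>c \<cdot> S d\<close> cancels first; only then are
    \<open>b\<close> and the argument of the remaining \<open>S\<close> adjacent components.\<close>
  have "?X = sw h (\<lambda>a r. sw (S a) (\<lambda>p q. sw r (\<lambda>b r. F (p \<cdot> (b \<cdot> S r)) (q \<cdot> one))))"
    by ((rule sw_cancel_first[OF antipode_right_unit, where sV = sV and f = "\<lambda>w e. F (p \<cdot> (b \<cdot> S e)) (q \<cdot> w)" for p q b]
        | rule sweedler_cong)+; intro li)
  also have "\<dots> = sw h (\<lambda>a r. sw (S a) (\<lambda>p q. sV (\<epsilon> r) (F (p \<cdot> one) (q \<cdot> one))))"
    by ((rule sw_cancel[OF antipode_right_unit, where sV = sV and g = "\<lambda>w. F (p \<cdot> w) (q \<cdot> one)" for p q] | rule sweedler_cong)+; intro li)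
  also have "\<dots> = sw h (\<lambda>a r. sV (\<epsilon> r) (sw (S a) F))"
    unfolding mult_one_right
    by (intro sweedler_cong sweedler_linear[where ?s1.0 = sV and ?s2.0 = sV and \<phi> = "sV c" for c, symmetric]
        linear_scaled_vector linear_same_argument V)
  also have "\<dots> = sw (S h) F"
    by (rule sw_counit_right[where sV = sV]; intro li F)
  finally have 1: "?X = sw (S h) F" .
  \<comment> \<open>\<open>K t u v\<close> is \<open>F\<close> on
    \<open>(u \<otimes> v)(S(t'') \<otimes> S(t'))\<close>. Hiding the last two components leaves
    \<open>\<Delta>(S(a)) \<Delta>(w)\<close>, the coproduct of
    \<open>S a \<cdot> w\<close>.\<close>
  define K where "K t u v = sw t (\<lambda>d e. F (u \<cdot> S e) (v \<cdot> S d))" for t u v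
  have K: "lin scale f \<Longrightarrow> lin sV (\<lambda>x. K (f x) a b)" "lin scale f \<Longrightarrow> lin sV (\<lambda>x. K a (f x) b)"
    "lin scale f \<Longrightarrow> lin sV (\<lambda>x. K a b (f x))" for f a b
    unfolding K_def by (intro li, assumption)+
  have "?X = sw h (\<lambda>a r. sw (S a) (\<lambda>p q. sw r (\<lambda>b r. sw r (\<lambda>c t. K t (p \<cdot> b) (q \<cdot> c)))))"
    by (simp add: K_def mult_assoc)
  also have "\<dots> = sw h (\<lambda>a r. sw (S a) (\<lambda>p q. sw r (\<lambda>w t. sw w (\<lambda>b c. K t (p \<cdot> b) (q \<cdot> c)))))"
    by ((rule sw_coassoc[where sV = sV, symmetric] | rule sweedler_cong)+; intro lin_intros K)
  also have "\<dots> = sw h (\<lambda>a r. sw r (\<lambda>w t. sw (S a) (\<lambda>p q. sw w (\<lambda>b c. K t (p \<cdot> b) (q \<cdot> c)))))"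
    by (rule sweedler_swap | rule sweedler_cong)+
  also have "\<dots> = sw h (\<lambda>a r. sw r (\<lambda>w t. sw (S a \<cdot> w) (K t)))"
    by ((rule sw_mult[where sV = sV, symmetric] | rule sweedler_cong)+; intro lin_intros K)
  also have "\<dots> = sw one (K h)"
    by (rule sw_cancel_first[OF antipode_left_unit, where sV = sV and f = "\<lambda>z t. sw z (K t)"];
        intro lin_intros K)
  also have "\<dots> = K h one one"
    by (rule sw_one[where sV = sV]; intro lin_intros K)
  finally show ?thesis using 1 by (simp add: K_def mult_one_left)
qed

end


section \<open>The twisted algebra\<close>

locale twisted_hopf_algebra = hopf_algebra scale mult one \<Delta> \<epsilon> S
  for scale :: "'k::field \<Rightarrow> 'h::ab_group_add \<Rightarrow> 'h"
    and mult one \<Delta> \<epsilon> S +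
  fixes \<eta> :: "'h \<Rightarrow> 'h \<Rightarrow> 'k"
  assumes cocycle: "normal_right_2_cocycle scale mult one \<Delta> \<epsilon> \<eta>"
    and cocycle_antipode_left: "sweedler scale scale (\<Delta> h) (\<lambda>h1 h2.
          \<eta> (twisted_antipode scale \<Delta> S \<eta> h1) h2) = \<epsilon> h"
    and cocycle_antipode_right: "sweedler scale scale (\<Delta> h) (\<lambda>h1 h2.
          \<eta> h1 (twisted_antipode scale \<Delta> S \<eta> h2)) = \<epsilon> h"
    and cocycle_antipode_mult:
      "sweedler scale scale (\<Delta> g) (\<lambda>g1 g2. sweedler scale scale (\<Delta> h) (\<lambda>h1 h2.
         \<eta> g1 h1 * \<eta> (twisted_antipode scale \<Delta> S \<eta> h2) (twisted_antipode scale \<Delta> S \<eta> g2))) =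
       sweedler scale scale (\<Delta> g) (\<lambda>g1 g2. sweedler scale scale (\<Delta> h) (\<lambda>h1 h2.
         \<eta> (mult g1 h1) (mult g2 h2)))"
begin

abbreviation star (infixl "\<star>" 70)
  where "x \<star> y \<equiv> star_mult scale mult \<Delta> \<eta> x y"

abbreviation s :: "'h \<Rightarrow> 'h"
  where "s h \<equiv> twisted_antipode scale \<Delta> S \<eta> h"

abbreviation act (infixr "\<triangleright>" 75)
  where "g \<triangleright> h \<equiv> star_action scale mult \<Delta> S \<eta> g h"

lemma eta_bilinear: "bilinear_map scale scale (*) \<eta>"
  using cocycle by (simp add: normal_right_2_cocycle_def)

lemma eta_one: "\<eta> one h = \<epsilon> h" "\<eta> h one = \<epsilon> h"
  using cocycle by (simp_all add: normal_right_2_cocycle_def)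

lemma lin_eta_left: "lin scale f \<Longrightarrow> lin (*) (\<lambda>x. \<eta> (f x) b)"
  by (rule linear_comp[OF _ bilinear_mapD(1)[OF eta_bilinear]])

lemma lin_eta_right: "lin scale f \<Longrightarrow> lin (*) (\<lambda>x. \<eta> b (f x))"
  by (rule linear_comp[OF _ bilinear_mapD(2)[OF eta_bilinear]])

lemma lin_star_left: "lin scale f \<Longrightarrow> lin scale (\<lambda>x. f x \<star> b)"
  unfolding star_mult_def by (intro lin_intros lin_eta_left lin_eta_right)

lemma lin_star_right: "lin scale f \<Longrightarrow> lin scale (\<lambda>x. b \<star> f x)"
  unfolding star_mult_def by (intro lin_intros lin_eta_left lin_eta_right)

lemma lin_s: "lin scale f \<Longrightarrow> lin scale (\<lambda>x. s (f x))"
  unfolding twisted_antipode_def by (intro lin_intros lin_eta_left lin_eta_right)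

lemma lin_act_left: "lin scale f \<Longrightarrow> lin scale (\<lambda>x. f x \<triangleright> b)"
  unfolding star_action_def by (intro lin_intros lin_star_left lin_star_right lin_s)

lemma lin_act_right: "lin scale f \<Longrightarrow> lin scale (\<lambda>x. b \<triangleright> f x)"
  unfolding star_action_def by (intro lin_intros lin_star_left lin_star_right lin_s)

lemmas lins = lin_intros lin_eta_left lin_eta_right lin_star_left lin_star_right lin_s
  lin_act_left lin_act_right

text \<open>In \<open>g \<star> h\<close> the cocycle takes the last components of \<open>g\<close>
  and \<open>h\<close>. By coassociativity it therefore joins the second tensor factor and turns
  that product into a star product.\<close>

lemma sw_star:
  assumes F: "\<And>b. lin sV (\<lambda>a. F a b)" "\<And>a. lin sV (F a)"
  shows "sw (g \<star> h) F = sw g (\<lambda>g1 g2. sw h (\<lambda>h1 h2. F (g1 \<cdot> h1) (g2 \<star> h2)))"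
proof -
  have V: "vector_space sV" by (rule linearD(5)[OF F(2)])
  note li = lins lin_arg[OF F(1)] lin_arg[OF F(2)] lin_scale_left[OF V] lin_scale_right[OF V]
  have swF: "lin sV (\<lambda>x. sw x F)" by (intro lins F)
  have "sw (g \<star> h) F = sw g (\<lambda>p g3. sw h (\<lambda>q h3. sV (\<eta> g3 h3) (sw (p \<cdot> q) F)))"
    unfolding star_mult_def
    by (simp only: sweedler_linear[OF swF] linearD(2)[OF swF])
  also have "\<dots> = sw g (\<lambda>p g3. sw h (\<lambda>q h3. sw p (\<lambda>g1 g2. sw q (\<lambda>h1 h2.
      sV (\<eta> g3 h3) (F (g1 \<cdot> h1) (g2 \<cdot> h2))))))"
    by (simp only: sw_mult[where sV = sV, OF F]
        sweedler_linear[OF linear_scaled_vector[OF V linear_same_argument[OF V]]])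
  also have "\<dots> = sw g (\<lambda>g1 r. sw h (\<lambda>h1 t. sw r (\<lambda>g2 g3. sw t (\<lambda>h2 h3.
      sV (\<eta> g3 h3) (F (g1 \<cdot> h1) (g2 \<cdot> h2))))))"
    by (rule sw_coassoc2[where sV = sV]; intro li)
  also have "\<dots> = sw g (\<lambda>g1 g2. sw h (\<lambda>h1 h2. F (g1 \<cdot> h1) (g2 \<star> h2)))"
    unfolding star_mult_def
    by (simp only: sweedler_linear[OF F(2)] linearD(2)[OF F(2)])
  finally show ?thesis .
qed

section \<open>Associativity and unit of the star product\<close>

lemma star_star_left:
  "(f \<star> g) \<star> h = sw f (\<lambda>f1 f2. sw g (\<lambda>g1 g2. sw h (\<lambda>h1 h2.
     scale (\<eta> (f2 \<star> g2) h2) (f1 \<cdot> g1 \<cdot> h1))))"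
  unfolding star_mult_def[of _ _ _ _ "f \<star> g"]
  by (rule sw_star[where sV = scale]; intro lins)

lemma star_star_right:
  "f \<star> (g \<star> h) = sw f (\<lambda>f1 f2. sw g (\<lambda>g1 g2. sw h (\<lambda>h1 h2.
     scale (\<eta> f2 (g2 \<star> h2)) (f1 \<cdot> (g1 \<cdot> h1)))))"
  unfolding star_mult_def[of _ _ _ _ f "g \<star> h"]
  by ((rule sw_star[where sV = scale] | rule sweedler_cong)+; intro lins)

text \<open>The cocycle identity itself: by linearity \<open>\<eta> (f \<star> g) h\<close> expands
  to its left side and \<open>\<eta> f (g \<star> h)\<close> to its right side.\<close>

lemma eta_star: "\<eta> (f \<star> g) h = \<eta> f (g \<star> h)"
proof -
  have L: "lin (*) (\<lambda>x. \<eta> x h)" and R: "lin (*) (\<eta> f)" by (intro lins)+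
  have "sw f (\<lambda>f1 f2. sw g (\<lambda>g1 g2. \<eta> (f1 \<cdot> g1) h * \<eta> f2 g2)) =
    sw g (\<lambda>g1 g2. sw h (\<lambda>h1 h2. \<eta> f (g1 \<cdot> h1) * \<eta> g2 h2))"
    using cocycle by (simp add: normal_right_2_cocycle_def)
  then show ?thesis
    unfolding star_mult_def sweedler_linear[OF L] sweedler_linear[OF R] linearD(2)[OF L] linearD(2)[OF R]
    by (simp only: mult.commute)
qed

lemma star_assoc: "(f \<star> g) \<star> h = f \<star> (g \<star> h)"
  unfolding star_star_left star_star_right eta_star mult_assoc ..

lemma star_one_left: "one \<star> h = h"
proof -
  have "one \<star> h = sw h (\<lambda>h1 h2. scale (\<eta> one h2) (one \<cdot> h1))"
    unfolding star_mult_def by (rule sw_one[where sV = scale]; intro lins)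
  then show ?thesis by (simp add: eta_one mult_one_left counit_right)
qed

lemma star_one_right: "h \<star> one = h"
proof -
  have "h \<star> one = sw h (\<lambda>h1 h2. scale (\<eta> h2 one) (h1 \<cdot> one))"
    unfolding star_mult_def by ((rule sw_one[where sV = scale] | rule sweedler_cong)+; intro lins)
  then show ?thesis by (simp add: eta_one mult_one_right counit_right)
qed

section \<open>The twisted antipode as a convolution inverse\<close>

lemma linear_scale_vector: "Vector_Spaces.linear (*) scale (\<lambda>c. scale c v)"
  by (intro linear_scaled_coefficient linear_same_argument vs vector_space_field)

lemma s_eq: "s h = sw h (\<lambda>a b. scale (sw a \<eta>) (S b))"
  unfolding twisted_antipode_def
  by (intro sweedler_cong sweedler_linear[OF linear_scale_vector, symmetric])

lemma s_one: "s one = one"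
proof -
  have "s one = scale (sw one \<eta>) (S one)"
    unfolding s_eq by (rule sw_one[where sV = scale]; intro lins)
  moreover have "sw one \<eta> = \<eta> one one"
    by (rule sw_one[where sV = "(*)"]; intro lins)
  ultimately show ?thesis by (simp add: antipode_one eta_one counit_one)
qed

text \<open>\<open>S\<close> reverses the coproduct, so the component of \<open>h\<close> next to
  the cocycle lands in the second tensor factor, where the two combine to \<open>s\<close>; the
  first factor keeps a plain \<open>S\<close>.\<close>

lemma sw_s:
  assumes F: "\<And>b. lin sV (\<lambda>a. F a b)" "\<And>a. lin sV (F a)"
  shows "sw (s h) F = sw h (\<lambda>a b. F (S b) (s a))"
proof -
  have V: "vector_space sV" by (rule linearD(5)[OF F(2)])
  note li = lins lin_arg[OF F(1)] lin_arg[OF F(2)] lin_scale_left[OF V] lin_scale_right[OF V]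
  have swF: "lin sV (\<lambda>x. sw x F)" by (intro lins F)
  have "sw (s h) F = sw h (\<lambda>a b. sV (sw a \<eta>) (sw (S b) F))"
    unfolding s_eq by (simp only: sweedler_linear[OF swF] linearD(2)[OF swF])
  also have "\<dots> = sw h (\<lambda>a b. sw b (\<lambda>c d. sV (sw a \<eta>) (F (S d) (S c))))"
    by (simp only: sw_antipode[where sV = sV, OF F]
        sweedler_linear[OF linear_scaled_vector[OF V linear_same_argument[OF V]]])
  also have "\<dots> = sw h (\<lambda>a b. sw a (\<lambda>c d. sV (sw c \<eta>) (F (S b) (S d))))"
    by (rule sw_coassoc[where sV = sV, symmetric]; intro li)
  also have "\<dots> = sw h (\<lambda>a b. F (S b) (s a))"
    unfolding s_eq by (simp only: sweedler_linear[OF F(2)] linearD(2)[OF F(2)])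
  finally show ?thesis .
qed

lemma s_star_s: "s h \<star> s g = sw h (\<lambda>h1 h2. sw g (\<lambda>g1 g2. scale (\<eta> (s h1) (s g1)) (S h2 \<cdot> S g2)))"
proof -
  have "s h \<star> s g = sw h (\<lambda>h1 h2. sw (s g) (\<lambda>u v. scale (\<eta> (s h1) v) (S h2 \<cdot> u)))"
    unfolding star_mult_def by (rule sw_s[where sV = scale]; intro lins)
  also have "\<dots> = sw h (\<lambda>h1 h2. sw g (\<lambda>g1 g2. scale (\<eta> (s h1) (s g1)) (S h2 \<cdot> S g2)))"
    by ((rule sw_s[where sV = scale] | rule sweedler_cong)+; intro lins)
  finally show ?thesis .
qed

lemma s_star: "s a \<star> b = sw a (\<lambda>a1 a2. sw b (\<lambda>b1 b2. scale (\<eta> (s a1) b2) (S a2 \<cdot> b1)))"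
  unfolding star_mult_def[of _ _ _ _ "s a"] by (rule sw_s[where sV = scale]; intro lins)

lemma star_s: "a \<star> s b = sw a (\<lambda>a1 a2. sw b (\<lambda>b1 b2. scale (\<eta> a2 (s b1)) (a1 \<cdot> S b2)))"
  unfolding star_mult_def[of _ _ _ _ _ "s b"]
  by ((rule sw_s[where sV = scale] | rule sweedler_cong)+; intro lins)

text \<open>With four components the sum is \<open>\<eta>(s(h1), h4) S(h2) h3\<close>. The inner
  antipode pair cancels, and the first condition on \<open>\<eta>\<close> evaluates the
  rest.\<close>

lemma star_s_left_unit: "convolves_to_unit (\<lambda>a b. s a \<star> b)"
  unfolding convolves_to_unit_def
proof (intro conjI allI lins)
  fix h
  have "sw h (\<lambda>a b. s a \<star> b) = sw h (\<lambda>a r. sw r (\<lambda>b q. sw q (\<lambda>c d.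
      scale (\<eta> (s a) d) (S b \<cdot> c))))"
    unfolding s_star by (rule sw_coassoc_middle[where sV = scale]; intro lins)
  also have "\<dots> = sw h (\<lambda>a r. scale (\<eta> (s a) r) one)"
    by ((rule sw_cancel_first[OF antipode_left_unit, where sV = scale and
          f = "\<lambda>w d. scale (\<eta> (s a) d) w" for a] | rule sweedler_cong)+; intro lins)
  also have "\<dots> = scale (\<epsilon> h) one"
    unfolding cocycle_antipode_left[symmetric]
    by (rule sweedler_linear[OF linear_scale_vector, symmetric])
  finally show "sw h (\<lambda>a b. s a \<star> b) = scale (\<epsilon> h) one" .
qed

text \<open>Here the sum is \<open>\<eta>(h2, s(h3)) h1 S(h4)\<close>, so the order is reversed: the
  second condition on \<open>\<eta>\<close> removes the inner pair, then the antipode law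
  applies.\<close>

lemma star_s_right_unit: "convolves_to_unit (\<lambda>a b. a \<star> s b)"
  unfolding convolves_to_unit_def
proof (intro conjI allI lins)
  fix h
  have *: "sw r (\<lambda>b q. sw q (\<lambda>c d. scale (\<eta> b (s c)) (a \<cdot> S d))) = a \<cdot> S r" for r a
  proof -
    have "sw r (\<lambda>b q. sw q (\<lambda>c d. scale (\<eta> b (s c)) (a \<cdot> S d))) =
        sw r (\<lambda>p d. sw p (\<lambda>b c. scale (\<eta> b (s c)) (a \<cdot> S d)))"
      by (rule sw_coassoc[where sV = scale, symmetric]; intro lins)
    also have "\<dots> = sw r (\<lambda>p d. scale (\<epsilon> p) (a \<cdot> S d))"
      unfolding cocycle_antipode_right[symmetric]
      by (intro sweedler_cong sweedler_linear[OF linear_scale_vector, symmetric])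
    also have "\<dots> = a \<cdot> S r"
      by (rule sw_counit_left[where sV = scale]; intro lins)
    finally show ?thesis .
  qed
  have "sw h (\<lambda>a b. a \<star> s b) = sw h (\<lambda>a r. sw r (\<lambda>b q. sw q (\<lambda>c d.
      scale (\<eta> b (s c)) (a \<cdot> S d))))"
    unfolding star_s by (rule sw_coassoc_middle[where sV = scale]; intro lins)
  then show "sw h (\<lambda>a b. a \<star> s b) = scale (\<epsilon> h) one"
    by (simp add: * antipode_right)
qed

text \<open>The third condition on \<open>\<eta>\<close> splits the cocycle coefficient of
  \<open>s (g \<cdot> h)\<close> into two factors. The second of them, with the antipodes of the
  last components, makes up \<open>s h2 \<star> s g2\<close> by \<open>s_star_s\<close>.\<close>

lemma s_mult: "s (g \<cdot> h) = sw g (\<lambda>g1 g2. sw h (\<lambda>h1 h2. scale (\<eta> g1 h1) (s h2 \<star> s g2)))"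
proof -
  have ls: "Vector_Spaces.linear scale scale (scale c)" for c
    by (intro lins)
  have e: "sw (g \<cdot> h) \<eta> = sw g (\<lambda>g1 g2. sw h (\<lambda>h1 h2. \<eta> g1 h1 * \<eta> (s h2) (s g2)))" for g h
    unfolding cocycle_antipode_mult by (rule sw_mult[where sV = "(*)"]; intro lins)
  have "s (g \<cdot> h) = sw g (\<lambda>p g3. sw h (\<lambda>q h3. scale (sw (p \<cdot> q) \<eta>) (S h3 \<cdot> S g3)))"
    unfolding s_eq by (subst sw_mult[where sV = scale]) (intro lins, intro lins, simp add: antipode_mult)
  also have "\<dots> = sw g (\<lambda>p g3. sw h (\<lambda>q h3. sw p (\<lambda>g1 g2. sw q (\<lambda>h1 h2.
      scale (\<eta> g1 h1) (scale (\<eta> (s h2) (s g2)) (S h3 \<cdot> S g3))))))"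
    unfolding e sweedler_linear[OF linear_scale_vector] by simp
  also have "\<dots> = sw g (\<lambda>g1 r. sw h (\<lambda>h1 t. sw r (\<lambda>g2 g3. sw t (\<lambda>h2 h3.
      scale (\<eta> g1 h1) (scale (\<eta> (s h2) (s g2)) (S h3 \<cdot> S g3))))))"
    by (rule sw_coassoc2[where sV = scale]; intro lins)
  also have "\<dots> = sw g (\<lambda>g1 r. sw h (\<lambda>h1 t. sw t (\<lambda>h2 h3. sw r (\<lambda>g2 g3.
      scale (\<eta> g1 h1) (scale (\<eta> (s h2) (s g2)) (S h3 \<cdot> S g3))))))"
    by (intro sweedler_cong, rule sweedler_swap)
  also have "\<dots> = sw g (\<lambda>g1 r. sw h (\<lambda>h1 t. scale (\<eta> g1 h1) (s t \<star> s r)))"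
    unfolding s_star_s sweedler_linear[OF ls] ..
  finally show ?thesis .
qed

section \<open>The twisted adjoint action\<close>

text \<open>The right side is \<open>h1 \<star> x \<star> s(h2) \<star> h3 \<star> y \<star>
  s(h4)\<close>, whose middle factors \<open>s(h2) \<star> h3\<close> cancel.\<close>

lemma act_product: "h \<triangleright> (x \<star> y) = sw h (\<lambda>h1 h2. (h1 \<triangleright> x) \<star> (h2 \<triangleright> y))"
proof -
  have ls: "lin scale (\<lambda>y. y \<star> x)" "lin scale ((\<star>) x)" for x by (intro lins)+
  have "sw h (\<lambda>h1 h2. (h1 \<triangleright> x) \<star> (h2 \<triangleright> y)) = sw h (\<lambda>p q. sw p (\<lambda>a b. sw q (\<lambda>c d.
      (a \<star> x \<star> s b) \<star> (c \<star> y \<star> s d))))"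
    unfolding star_action_def sweedler_linear[OF ls(1)] sweedler_linear[OF ls(2)]
    by (intro sweedler_cong, rule sweedler_swap)
  also have "\<dots> = sw h (\<lambda>a r. sw r (\<lambda>b q. sw q (\<lambda>c d.
      (a \<star> x \<star> s b) \<star> (c \<star> y \<star> s d))))"
    by (rule sw_coassoc_middle[where sV = scale]; intro lins)
  also have "\<dots> = sw h (\<lambda>a r. sw r (\<lambda>b q. sw q (\<lambda>c d.
      a \<star> x \<star> (s b \<star> c) \<star> (y \<star> s d))))"
    by (simp only: star_assoc)
  also have "\<dots> = sw h (\<lambda>a r. a \<star> x \<star> one \<star> (y \<star> s r))"
    by ((rule sw_cancel_first[OF star_s_left_unit, where sV = scale and
          f = "\<lambda>w d. a \<star> x \<star> w \<star> (y \<star> s d)" for a] | rule sweedler_cong)+; intro lins)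
  also have "\<dots> = h \<triangleright> (x \<star> y)"
    by (simp only: star_action_def star_one_right star_assoc)
  finally show ?thesis ..
qed

lemma act_one: "one \<triangleright> x = x"
proof -
  have "one \<triangleright> x = one \<star> x \<star> s one"
    unfolding star_action_def by (rule sw_one[where sV = scale]; intro lins)
  then show ?thesis by (simp add: s_one star_one_left star_one_right)
qed

lemma act_unit: "h \<triangleright> one = scale (\<epsilon> h) one"
  using star_s_right_unit by (simp add: star_action_def star_one_right convolves_to_unit_def)

lemma act_mult: "(g \<cdot> h) \<triangleright> x = g \<triangleright> (h \<triangleright> x)"
proof -
  have ls: "lin scale (\<lambda>y. y \<star> x)" "lin scale ((\<star>) x)" "lin scale (scale c)" for x c
    by (intro lins)+
  \<comment> \<open>This expansion yields the same factor \<open>\<eta> g2 h2\<close> that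
    \<open>s_mult\<close> contributes, so the two sides meet after regrouping.\<close>
  have pq: "p \<star> q \<star> x \<star> y = sw p (\<lambda>g1 g2. sw q (\<lambda>h1 h2.
      scale (\<eta> g2 h2) (g1 \<cdot> h1 \<star> x \<star> y)))" for p q y
    unfolding star_mult_def[of _ _ _ _ p q] sweedler_linear[OF ls(1)] linearD(2)[OF ls(1)] ..
  have "(g \<cdot> h) \<triangleright> x = sw g (\<lambda>g1 r. sw h (\<lambda>h1 t. g1 \<cdot> h1 \<star> x \<star> s (r \<cdot> t)))"
    unfolding star_action_def by (rule sw_mult[where sV = scale]; intro lins)
  also have "\<dots> = sw g (\<lambda>g1 r. sw h (\<lambda>h1 t. sw r (\<lambda>g2 g3. sw t (\<lambda>h2 h3.
      scale (\<eta> g2 h2) (g1 \<cdot> h1 \<star> x \<star> (s h3 \<star> s g3))))))"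
    unfolding s_mult sweedler_linear[OF ls(2)] linearD(2)[OF ls(2)] ..
  also have "\<dots> = sw g (\<lambda>p g3. sw h (\<lambda>q h3. sw p (\<lambda>g1 g2. sw q (\<lambda>h1 h2.
      scale (\<eta> g2 h2) (g1 \<cdot> h1 \<star> x \<star> (s h3 \<star> s g3))))))"
    by (rule sw_coassoc2[where sV = scale, symmetric]; intro lins)
  also have "\<dots> = sw g (\<lambda>p g3. sw h (\<lambda>q h3. p \<star> q \<star> x \<star> (s h3 \<star> s g3)))"
    unfolding pq ..
  also have "\<dots> = g \<triangleright> (h \<triangleright> x)"
    unfolding star_action_def sweedler_linear[OF ls(1)] sweedler_linear[OF ls(2)]
    by (simp only: star_assoc)
  finally show ?thesis .
qed

text \<open>In other words \<open>\<Delta>(h \<triangleright> x) = h1 x' S(h3) \<otimes> (h2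
  \<triangleright> x'')\<close>: the reversal in \<open>sw_s\<close> leaves the outer components of
  \<open>h\<close> on the left, and the inner ones form an action again.\<close>

lemma sw_act:
  assumes F: "\<And>b. lin sV (\<lambda>a. F a b)" "\<And>a. lin sV (F a)"
  shows "sw (h \<triangleright> x) F = sw h (\<lambda>a r. sw r (\<lambda>q d. sw x (\<lambda>x1 x2. F (a \<cdot> x1 \<cdot> S d) (q \<triangleright> x2))))"
proof -
  note li = lins lin_arg[OF F(1)] lin_arg[OF F(2)]
  have swF: "lin sV (\<lambda>x. sw x F)" by (intro lins F)
  have st: "sw (a \<star> x \<star> s b) F = sw a (\<lambda>a1 a2. sw b (\<lambda>b1 b2. sw x (\<lambda>x1 x2.
      F (a1 \<cdot> x1 \<cdot> S b2) (a2 \<star> x2 \<star> s b1))))" for a b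
  proof -
    have "sw (a \<star> x \<star> s b) F =
        sw (a \<star> x) (\<lambda>u v. sw (s b) (\<lambda>w z. F (u \<cdot> w) (v \<star> z)))"
      by (rule sw_star[where sV = sV]; intro li)
    also have "\<dots> = sw (a \<star> x) (\<lambda>u v. sw b (\<lambda>b1 b2. F (u \<cdot> S b2) (v \<star> s b1)))"
      by ((rule sw_s[where sV = sV] | rule sweedler_cong)+; intro li)
    also have "\<dots> = sw a (\<lambda>a1 a2. sw x (\<lambda>x1 x2. sw b (\<lambda>b1 b2.
        F (a1 \<cdot> x1 \<cdot> S b2) (a2 \<star> x2 \<star> s b1))))"
      by (rule sw_star[where sV = sV]; intro li)
    also have "\<dots> = sw a (\<lambda>a1 a2. sw b (\<lambda>b1 b2. sw x (\<lambda>x1 x2.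
        F (a1 \<cdot> x1 \<cdot> S b2) (a2 \<star> x2 \<star> s b1))))"
      by (intro sweedler_cong, rule sweedler_swap)
    finally show ?thesis .
  qed
  have "sw (h \<triangleright> x) F = sw h (\<lambda>a b. sw (a \<star> x \<star> s b) F)"
    unfolding star_action_def by (rule sweedler_linear[OF swF])
  also have "\<dots> = sw h (\<lambda>a r. sw r (\<lambda>b q. sw q (\<lambda>c d. sw x (\<lambda>x1 x2.
      F (a \<cdot> x1 \<cdot> S d) (b \<star> x2 \<star> s c)))))"
    unfolding st by (rule sw_coassoc_middle[where sV = sV]; intro li)
  also have "\<dots> = sw h (\<lambda>a r. sw r (\<lambda>q d. sw q (\<lambda>b c. sw x (\<lambda>x1 x2.
      F (a \<cdot> x1 \<cdot> S d) (b \<star> x2 \<star> s c)))))"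
    by ((rule sw_coassoc[where sV = sV, symmetric] | rule sweedler_cong)+; intro li)
  also have "\<dots> = sw h (\<lambda>a r. sw r (\<lambda>q d. sw x (\<lambda>x1 x2. sw q (\<lambda>b c.
      F (a \<cdot> x1 \<cdot> S d) (b \<star> x2 \<star> s c)))))"
    by (intro sweedler_cong, rule sweedler_swap)
  also have "\<dots> = sw h (\<lambda>a r. sw r (\<lambda>q d. sw x (\<lambda>x1 x2. F (a \<cdot> x1 \<cdot> S d) (q \<triangleright> x2))))"
    unfolding star_action_def sweedler_linear[OF F(2)] ..
  finally show ?thesis .
qed

text \<open>By \<open>sw_act\<close> the left side has first tensor factor
  \<open>h1 x' S(h3) h4\<close>, and \<open>S(h3) h4\<close> cancels.\<close>

lemma yetter_drinfeld_condition:
  "sw h (\<lambda>h1 h2. sw (h1 \<triangleright> x) (\<lambda>u v. tensor scale scale (u \<cdot> h2) v)) =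
   sw h (\<lambda>h1 h2. sw x (\<lambda>u v. tensor scale scale (h1 \<cdot> u) (h2 \<triangleright> v)))"
proof -
  let ?f = "\<lambda>a q d e. sw x (\<lambda>x1 x2. tensor scale scale (a \<cdot> x1 \<cdot> (S d \<cdot> e)) (q \<triangleright> x2))"
  have "sw h (\<lambda>h1 h2. sw (h1 \<triangleright> x) (\<lambda>u v. tensor scale scale (u \<cdot> h2) v)) =
      sw h (\<lambda>h1 h2. sw h1 (\<lambda>a r. sw r (\<lambda>q d. sw x (\<lambda>x1 x2.
        tensor scale scale (a \<cdot> x1 \<cdot> S d \<cdot> h2) (q \<triangleright> x2)))))"
    by ((rule sw_act[where sV = tensor_scale] | rule sweedler_cong)+; intro lins)
  also have "\<dots> = sw h (\<lambda>p e. sw p (\<lambda>a r. sw r (\<lambda>q d. ?f a q d e)))"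
    by (simp only: mult_assoc)
  also have "\<dots> = sw h (\<lambda>a t. sw t (\<lambda>r e. sw r (\<lambda>q d. ?f a q d e)))"
    by (rule sw_coassoc[where sV = tensor_scale]; intro lins)
  also have "\<dots> = sw h (\<lambda>a t. sw t (\<lambda>q r. sw r (\<lambda>d e. ?f a q d e)))"
    by ((rule sw_coassoc[where sV = tensor_scale] | rule sweedler_cong)+; intro lins)
  also have "\<dots> = sw h (\<lambda>a t. sw x (\<lambda>x1 x2. tensor scale scale (a \<cdot> x1 \<cdot> one) (t \<triangleright> x2)))"
    by ((rule sw_cancel_last[OF antipode_left_unit, where sV = tensor_scale and
          f = "\<lambda>q w. sw x (\<lambda>x1 x2. tensor scale scale (a \<cdot> x1 \<cdot> w) (q \<triangleright> x2))" for a]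
        | rule sweedler_cong)+; intro lins)
  finally show ?thesis by (simp only: mult_one_right)
qed

lemma star_braided: "y \<star> x = sw y (\<lambda>u v. (u \<triangleright> x) \<star> v)"
proof -
  have ls: "lin scale (\<lambda>y. y \<star> x)" for x by (intro lins)
  have "sw y (\<lambda>u v. (u \<triangleright> x) \<star> v) = sw y (\<lambda>u c. sw u (\<lambda>a b. a \<star> x \<star> (s b \<star> c)))"
    unfolding star_action_def sweedler_linear[OF ls] by (simp only: star_assoc)
  also have "\<dots> = sw y (\<lambda>a r. sw r (\<lambda>b c. a \<star> x \<star> (s b \<star> c)))"
    by (rule sw_coassoc[where sV = scale]; intro lins)
  also have "\<dots> = y \<star> x \<star> one"
    by (rule sw_cancel_last[OF star_s_left_unit, where sV = scale and f = "\<lambda>a w. a \<star> x \<star> w"]; intro lins)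
  finally show ?thesis by (simp only: star_one_right)
qed

section \<open>Verification of the algebraic structures\<close>

lemma star_algebra: "k_algebra scale star one"
proof unfold_locales
  show "bilinear_map scale scale scale star"
    by (intro bilinear_mapI lins)
qed (fact star_assoc star_one_left star_one_right)+

lemma star_yetter_drinfeld:
  "yetter_drinfeld_module_algebra scale mult one \<Delta> \<epsilon> S scale star one act \<Delta>"
proof -
  have hopf: "hopf_algebra scale mult one \<Delta> \<epsilon> S" by unfold_locales
  \<comment> \<open>\<open>sw_star\<close> with \<open>F\<close> the pure tensor. As the coaction is
    \<open>\<Delta>\<close>, the remaining comodule laws come from the Hopf algebra axioms.\<close>
  have comult: "\<Delta> (x \<star> y) = tensor_mult scale scale mult star (\<Delta> x) (\<Delta> y)" for x y
    unfolding tensor_mult_def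
    by (rule trans[OF comult_sw], rule sw_star[where sV = tensor_scale]; intro lins)
  have bil: "bilinear_map scale scale scale act"
    by (intro bilinear_mapI lins)
  have "left_module_algebra scale mult one \<Delta> \<epsilon> S scale star one act"
    unfolding left_module_algebra_def left_module_algebra_axioms_def
    by (intro conjI allI hopf star_algebra bil act_mult act_one act_product act_unit)
  moreover have "left_comodule_algebra scale mult one \<Delta> \<epsilon> S scale star one \<Delta>"
    unfolding left_comodule_algebra_def left_comodule_algebra_axioms_def
    by (intro conjI allI hopf star_algebra comult_linear comult_in_tensor comult_coassoc
        counit_left comult comult_one)
  moreover have "yetter_drinfeld_module_algebra_axioms scale mult \<Delta> scale act \<Delta>"
    unfolding yetter_drinfeld_module_algebra_axioms_def
    by (intro allI yetter_drinfeld_condition)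
  ultimately show ?thesis
    unfolding yetter_drinfeld_module_algebra_def by blast
qed

end

theorem theorem2p4p3:
  fixes scale :: "'k::field \<Rightarrow> 'h::ab_group_add \<Rightarrow> 'h"
    and mult :: "'h \<Rightarrow> 'h \<Rightarrow> 'h"
    and one :: 'h
    and \<Delta> :: "'h \<Rightarrow> ('h, 'h, 'k) tensor2"
    and \<epsilon> :: "'h \<Rightarrow> 'k"
    and S :: "'h \<Rightarrow> 'h"
    and \<eta> :: "'h \<Rightarrow> 'h \<Rightarrow> 'k"
  assumes "hopf_algebra scale mult one \<Delta> \<epsilon> S"
    and "bij S"
    and "normal_right_2_cocycle scale mult one \<Delta> \<epsilon> \<eta>"
    and "\<And>h. sweedler scale scale (\<Delta> h) (\<lambda>h1 h2.
          \<eta> (twisted_antipode scale \<Delta> S \<eta> h1) h2) = \<epsilon> h"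
    and "\<And>h. sweedler scale scale (\<Delta> h) (\<lambda>h1 h2.
          \<eta> h1 (twisted_antipode scale \<Delta> S \<eta> h2)) = \<epsilon> h"
    and "\<And>g h.
          sweedler scale scale (\<Delta> g) (\<lambda>g1 g2. sweedler scale scale (\<Delta> h) (\<lambda>h1 h2.
            \<eta> g1 h1 * \<eta> (twisted_antipode scale \<Delta> S \<eta> h2) (twisted_antipode scale \<Delta> S \<eta> g2))) =
          sweedler scale scale (\<Delta> g) (\<lambda>g1 g2. sweedler scale scale (\<Delta> h) (\<lambda>h1 h2.
            \<eta> (mult g1 h1) (mult g2 h2)))"
  shows "yetter_drinfeld_module_algebra scale mult one \<Delta> \<epsilon> S
           scale (star_mult scale mult \<Delta> \<eta>) one (star_action scale mult \<Delta> S \<eta>) \<Delta> \<and>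
         braided_commutative scale scale (star_mult scale mult \<Delta> \<eta>)
           (star_action scale mult \<Delta> S \<eta>) \<Delta>"
proof -
  interpret twisted_hopf_algebra scale mult one \<Delta> \<epsilon> S \<eta>
    using assms unfolding twisted_hopf_algebra_def twisted_hopf_algebra_axioms_def by blast
  show ?thesis
    using star_yetter_drinfeld star_braided unfolding braided_commutative_def by blast
qed

end
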